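(* Let $\mathcal{C}$ be a $d$-clutter on $[n]$ such that $\Delta=\langle\mathcal{C}\rangle$ is vertex decomposable. Then $\mathcal{C}$ is both a CF-tree and chordal. In particular, if $\Delta$ is a pure $d$-dimensional vertex decomposable simplicial complex on $[n]$ and $\Delta'$ is obtained from $\Delta$ by adding all faces of dimension $<d$ (that is, all subsets of $[n]$ with at most $d$ elements), then $I_{\Delta'}$ has a linear resolution.
   Context: Let $[n]=\{1,\ldots,n\}$ and let $d\ge 0$ be an integer. A $d$-clutter on $[n]$ is a family $\mathcal{C}$ of $(d+1)$-subsets of $[n]$, called circuits. $\langle\mathcal{C}\rangle$ is the simplicial complex whose set of facets is $\mathcal{C}$. A simplicial complex on $[n]$ need not contain all singletons $\{i\}$; its vertices are those $i$ with $\{i\}$ a face. Chordality: a maximal subcircuit (MS) of $\mathcal{C}$ is a $d$-subset of $[n]$ contained in some circuit; $\mathcal{MS}(\mathcal{C})$ is the set of them; $\deg(e)$ is the number of circuits containing $e$. For $e\subseteq[n]$, $\mathcal{C}-e$ is the family of circuits that do not contain $e$. A set $L\subseteq[n]$ is a clique in $\mathcal{C}$ if every $(d+1)$-subset of $L$ is in $\mathcal{C}$. For an MS $e$, $\mathrm{N}[e]=e\cup\{v\in[n]: e\cup\{v\}\in\mathcal{C}\}$; $e$ is simplicial if $\mathrm{N}[e]$ is a clique. $\mathcal{C}$ is chordal if it is empty or there is a sequence $e_1,\ldots,e_t$ such that $e_i$ is a simplicial maximal subcircuit of $\mathcal{C}-e_1-\cdots-e_{i-1}$ for each $i$ and $\mathcal{C}-e_1-\cdots-e_t=\emptyset$.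 CF-trees: a $d$-clutter is strongly connected if for any two circuits $F_1,F_2$ there is a sequence of circuits starting with $F_1$ and ending with $F_2$ in which consecutive circuits share a common MS. A $d$-dimensional CF-cycle is a nonempty strongly connected $d$-clutter in which $\deg(e)$ is even for each MS $e$. A $d$-dimensional CF-tree is a nonempty $d$-clutter that contains no CF-cycle as a subfamily. Vertex decomposability: a pure simplicial complex $\Delta$ having at least one vertex is vertex decomposable if either it is a simplex (has exactly one facet), or there is a vertex $v$ of $\Delta$ such that both $\mathrm{link}_\Delta v=\{G\setminus\{v\}: v\in G\in\Delta\}$ and $\Delta\setminus v=\{G\in\Delta: v\notin G\}$ are pure and vertex decomposable. The complex $\{\emptyset\}$ is not regarded as vertex decomposable; thus the 0-dimensional vertex decomposable complexes are exactly those with a single vertex. $I_{\Delta'}\subseteq S=k[x_1,\ldots,x_n]$ ($k$ a field) is the Stanley–Reisner ideal, generated by the $x_F=\prod_{i\in F}x_i$ with $F$ a minimal non-face of $\Delta'$ ($F\subseteq[n]$). The zero ideal is regarded as having a linear resolution. *)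

theory Defs
  imports
    "HOL-Library.Poly_Mapping"
    "HOL-Algebra.Ideal"
    "Jordan_Normal_Form.Matrix"
begin

section \<open>Clutters and simplicial complexes on $[n] = \{1,\ldots,n\}$\<close>

definition d_clutter :: "nat \<Rightarrow> nat \<Rightarrow> nat set set \<Rightarrow> bool" where
  "d_clutter n d C \<longleftrightarrow> (\<forall>F\<in>C. F \<subseteq> {1..n} \<and> card F = d + 1)"

text \<open>As usual, a simplicial complex contains the empty face; \<open>{{}}\<close> is the complex without
  vertices.\<close>

definition simplicial_complex :: "nat \<Rightarrow> nat set set \<Rightarrow> bool" where
  "simplicial_complex n \<Delta> \<longleftrightarrow>
     {} \<in> \<Delta> \<and> (\<forall>G\<in>\<Delta>. G \<subseteq> {1..n}) \<and> (\<forall>G\<in>\<Delta>. \<forall>H. H \<subseteq> G \<longrightarrow> H \<in> \<Delta>)"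

definition facets :: "nat set set \<Rightarrow> nat set set" where
  "facets \<Delta> = {F\<in>\<Delta>. \<forall>G\<in>\<Delta>. F \<subseteq> G \<longrightarrow> F = G}"

definition vertices :: "nat set set \<Rightarrow> nat set" where
  "vertices \<Delta> = {v. {v} \<in> \<Delta>}"

definition complex_dim :: "nat set set \<Rightarrow> int" where
  "complex_dim \<Delta> = int (Max (card ` \<Delta>)) - 1"

definition pure_complex :: "nat set set \<Rightarrow> bool" where
  "pure_complex \<Delta> \<longleftrightarrow> (\<forall>F\<in>facets \<Delta>. \<forall>G\<in>facets \<Delta>. card F = card G)"

text \<open>Since the circuits of a \<open>d\<close>-clutter all have the same cardinality, they are exactly the
  facets of the complex they generate.\<close>

definition complex_of :: "nat set set \<Rightarrow> nat set set" where
  "complex_of C = {G. \<exists>F\<in>C. G \<subseteq> F}"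

definition link :: "nat set set \<Rightarrow> nat \<Rightarrow> nat set set" where
  "link \<Delta> v = {G - {v} | G. G \<in> \<Delta> \<and> v \<in> G}"

definition deletion :: "nat set set \<Rightarrow> nat \<Rightarrow> nat set set" where
  "deletion \<Delta> v = {G\<in>\<Delta>. v \<notin> G}"

inductive vertex_decomposable :: "nat \<Rightarrow> nat set set \<Rightarrow> bool" for n where
  simplex:
    "\<lbrakk>simplicial_complex n \<Delta>; pure_complex \<Delta>; vertices \<Delta> \<noteq> {}; \<exists>F. facets \<Delta> = {F}\<rbrakk>
      \<Longrightarrow> vertex_decomposable n \<Delta>"
| decompose:
    "\<lbrakk>simplicial_complex n \<Delta>; pure_complex \<Delta>; v \<in> vertices \<Delta>;
      pure_complex (link \<Delta> v); vertex_decomposable n (link \<Delta> v);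
      pure_complex (deletion \<Delta> v); vertex_decomposable n (deletion \<Delta> v)\<rbrakk>
      \<Longrightarrow> vertex_decomposable n \<Delta>"


section \<open>Chordal clutters\<close>

definition max_subcircuits :: "nat \<Rightarrow> nat \<Rightarrow> nat set set \<Rightarrow> nat set set" where
  "max_subcircuits n d C = {e. e \<subseteq> {1..n} \<and> card e = d \<and> (\<exists>F\<in>C. e \<subseteq> F)}"

definition circuit_deg :: "nat set set \<Rightarrow> nat set \<Rightarrow> nat" where
  "circuit_deg C e = card {F\<in>C. e \<subseteq> F}"

definition remove_subcircuit :: "nat set set \<Rightarrow> nat set \<Rightarrow> nat set set" where
  "remove_subcircuit C e = {F\<in>C. \<not> e \<subseteq> F}"

definition clutter_clique :: "nat \<Rightarrow> nat \<Rightarrow> nat set set \<Rightarrow> nat set \<Rightarrow> bool" where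
  "clutter_clique n d C L \<longleftrightarrow> L \<subseteq> {1..n} \<and> (\<forall>F. F \<subseteq> L \<and> card F = d + 1 \<longrightarrow> F \<in> C)"

definition closed_nbhd :: "nat \<Rightarrow> nat set set \<Rightarrow> nat set \<Rightarrow> nat set" where
  "closed_nbhd n C e = e \<union> {v\<in>{1..n}. e \<union> {v} \<in> C}"

definition simplicial_subcircuit :: "nat \<Rightarrow> nat \<Rightarrow> nat set set \<Rightarrow> nat set \<Rightarrow> bool" where
  "simplicial_subcircuit n d C e \<longleftrightarrow>
     e \<in> max_subcircuits n d C \<and> clutter_clique n d C (closed_nbhd n C e)"

definition chordal :: "nat \<Rightarrow> nat \<Rightarrow> nat set set \<Rightarrow> bool" where
  "chordal n d C \<longleftrightarrow>
     C = {} \<or>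
     (\<exists>es. (\<forall>i<length es.
              simplicial_subcircuit n d (foldl remove_subcircuit C (take i es)) (es ! i)) \<and>
           foldl remove_subcircuit C es = {})"


section \<open>CF-trees\<close>

definition strongly_connected :: "nat \<Rightarrow> nat \<Rightarrow> nat set set \<Rightarrow> bool" where
  "strongly_connected n d C \<longleftrightarrow>
     (\<forall>F1\<in>C. \<forall>F2\<in>C. \<exists>Fs. Fs \<noteq> [] \<and> hd Fs = F1 \<and> last Fs = F2 \<and> set Fs \<subseteq> C \<and>
        (\<forall>i. Suc i < length Fs \<longrightarrow>
           (\<exists>e\<in>max_subcircuits n d C. e \<subseteq> Fs ! i \<and> e \<subseteq> Fs ! Suc i)))"

definition CF_cycle :: "nat \<Rightarrow> nat \<Rightarrow> nat set set \<Rightarrow> bool" where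
  "CF_cycle n d C \<longleftrightarrow>
     d_clutter n d C \<and> C \<noteq> {} \<and> strongly_connected n d C \<and>
     (\<forall>e\<in>max_subcircuits n d C. even (circuit_deg C e))"

definition CF_tree :: "nat \<Rightarrow> nat \<Rightarrow> nat set set \<Rightarrow> bool" where
  "CF_tree n d C \<longleftrightarrow> d_clutter n d C \<and> C \<noteq> {} \<and> \<not> (\<exists>Z\<subseteq>C. CF_cycle n d Z)"


section \<open>Stanley--Reisner ideals\<close>

text \<open>A polynomial is a finitely supported map from monomials to coefficients, and a monomial a
  finitely supported map from the indices of the variables to exponents. The type provides a
  variable for every natural number, so $k[x_1,\ldots,x_n]$ is carved out by its carrier.\<close>

type_synonym monomial = "nat \<Rightarrow>\<^sub>0 nat"

type_synonym 'k polynomial = "monomial \<Rightarrow>\<^sub>0 'k"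

definition poly_ring :: "nat \<Rightarrow> ('k::field polynomial) ring" where
  "poly_ring n =
     \<lparr>carrier = {p. \<forall>m\<in>Poly_Mapping.keys p. Poly_Mapping.keys m \<subseteq> {1..n}},
      monoid.mult = (*), one = 1, zero = 0, add = (+)\<rparr>"

definition indet :: "nat \<Rightarrow> 'k::field polynomial" where
  "indet i = Poly_Mapping.single (Poly_Mapping.single i 1) 1"

definition min_nonfaces :: "nat \<Rightarrow> nat set set \<Rightarrow> nat set set" where
  "min_nonfaces n \<Delta> = {F. F \<subseteq> {1..n} \<and> F \<notin> \<Delta> \<and> (\<forall>G. G \<subset> F \<longrightarrow> G \<in> \<Delta>)}"

definition stanley_reisner_ideal :: "nat \<Rightarrow> nat set set \<Rightarrow> 'k::field polynomial set" where
  "stanley_reisner_ideal n \<Delta> =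
     genideal (poly_ring n) ((\<lambda>F. \<Prod>i\<in>F. indet i) ` min_nonfaces n \<Delta>)"

definition add_small_faces :: "nat \<Rightarrow> nat \<Rightarrow> nat set set \<Rightarrow> nat set set" where
  "add_small_faces n d \<Delta> = \<Delta> \<union> {G. G \<subseteq> {1..n} \<and> card G \<le> d}"


section \<open>Minimal graded free resolutions and linear resolutions\<close>

definition monomial_degree :: "monomial \<Rightarrow> nat" where
  "monomial_degree m = (\<Sum>i\<in>Poly_Mapping.keys m. Poly_Mapping.lookup m i)"

definition free_module :: "nat \<Rightarrow> nat \<Rightarrow> 'k::field polynomial vec set" where
  "free_module n r = {v \<in> carrier_vec r. \<forall>j<r. v $ j \<in> carrier (poly_ring n)}"

text \<open>The sequence
  $\cdots \to F_2 \stackrel{M_1}{\to} F_1 \stackrel{M_0}{\to} F_0 \stackrel{g}{\to} I \to 0$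
  where $F_i = \bigoplus_{j < b_i} S(-a_{i,j})$, i.e. the $j$-th basis element of $F_i$ has degree
  $a_{i,j}$. All maps are homogeneous of degree $0$: the $(r,c)$ entry of $M_i$ is zero or
  homogeneous of degree $a_{i+1,c} - a_{i,r}$, which is phrased additively to avoid truncated
  subtraction. Ranks eventually zero are not demanded; this is automatic by Hilbert's syzygy
  theorem.\<close>

definition graded_free_resolution ::
  "nat \<Rightarrow> 'k::field polynomial set \<Rightarrow> (nat \<Rightarrow> nat) \<Rightarrow> (nat \<Rightarrow> nat \<Rightarrow> nat) \<Rightarrow>
   'k polynomial vec \<Rightarrow> (nat \<Rightarrow> 'k polynomial mat) \<Rightarrow> bool" where
  "graded_free_resolution n I b a g M \<longleftrightarrow>
     g \<in> free_module n (b 0) \<and>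
     (\<forall>j<b 0. \<forall>m\<in>Poly_Mapping.keys (g $ j). monomial_degree m = a 0 j) \<and>
     (\<forall>i. M i \<in> carrier_mat (b i) (b (Suc i)) \<and>
        (\<forall>r<b i. \<forall>c<b (Suc i). M i $$ (r, c) \<in> carrier (poly_ring n) \<and>
           (\<forall>m\<in>Poly_Mapping.keys (M i $$ (r, c)).
              a i r + monomial_degree m = a (Suc i) c))) \<and>
     (\<lambda>v. g \<bullet> v) ` free_module n (b 0) = I \<and>
     {v \<in> free_module n (b 0). g \<bullet> v = 0} = (\<lambda>w. M 0 *\<^sub>v w) ` free_module n (b 1) \<and>
     (\<forall>i. {v \<in> free_module n (b (Suc i)). M i *\<^sub>v v = 0\<^sub>v (b i)} =
          (\<lambda>w. M (Suc i) *\<^sub>v w) ` free_module n (b (Suc (Suc i))))"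

text \<open>Minimality: $M_i(F_{i+1}) \subseteq (x_1,\ldots,x_n) F_i$, that is, no matrix entry has a
  constant term.\<close>

definition minimal_graded_free_resolution ::
  "nat \<Rightarrow> 'k::field polynomial set \<Rightarrow> (nat \<Rightarrow> nat) \<Rightarrow> (nat \<Rightarrow> nat \<Rightarrow> nat) \<Rightarrow>
   'k polynomial vec \<Rightarrow> (nat \<Rightarrow> 'k polynomial mat) \<Rightarrow> bool" where
  "minimal_graded_free_resolution n I b a g M \<longleftrightarrow>
     graded_free_resolution n I b a g M \<and>
     (\<forall>i. \<forall>r<b i. \<forall>c<b (Suc i). Poly_Mapping.lookup (M i $$ (r, c)) 0 = 0)"

text \<open>The minimal graded free resolution is unique up to isomorphism, so it does not matter which
  one is inspected. The zero ideal qualifies, with all ranks zero.\<close>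

definition has_linear_resolution :: "nat \<Rightarrow> 'k::field polynomial set \<Rightarrow> bool" where
  "has_linear_resolution n I \<longleftrightarrow>
     (\<exists>q b a g M. minimal_graded_free_resolution n I b a g M \<and>
        (\<forall>i. \<forall>j<b i. a i j = q + i))"

end

(* By induction along a vertex decomposition, with shedding vertex v, link L and deletion D:

   - The circuits can be removed one at a time, each through a subcircuit lying in no other
     remaining circuit: use the subcircuits v + e for the removals in L, then those of D.
     Such a subcircuit is simplicial, so the clutter is chordal. In a nonempty subfamily, the
     subcircuit removing the first of its circuits has degree 1, so not all degrees are even.

   - The boundary of a simplex has even degrees, so every (d+1)-set has a d-subset outside L, and
     the minimal non-faces of the completed complex are exactly the (d+1)-sets that are not
     circuits. Their ideal is x_v I_L + I_D with I_D contained in I_L (a vertex splitting), hence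
     has linear quotients.

   - The first syzygies of a sequence of vectors with linear quotients again have linear quotients,
     with generators of degree 1. Iterating gives the linear resolution. *)
theory Submission
  imports Defs
begin

section \<open>Polynomials and squarefree monomials\<close>

text \<open>Syzygies lie in free modules rather than in the ring, so linear quotients are formulated
  for sequences of vectors; only in this form does the passage to first syzygies iterate. Ideals
  generated by variables or by squarefree monomials are described monomial by monomial, which
  reduces questions about membership and colon ideals to questions about supports.

  The inclusion of I_D in I_L is where the two halves meet: a non-circuit of D needs a d-subset
  outside L, and the elimination order of L supplies one. A degenerate case needs separate
  treatment: if v lies in every circuit, the deletion drops in dimension and D is empty, so that I_D
  is generated by all (d+1)-sets avoiding v.\<close>

lemma lookup_single_times:
  fixes k :: "'a::cancel_comm_monoid_add" and p :: "'a \<Rightarrow>\<^sub>0 'b::comm_semiring_1"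
  shows "Poly_Mapping.lookup (Poly_Mapping.single k 1 * p) (k + m) = Poly_Mapping.lookup p m"
  by (simp add: lookup_mult lookup_single when_mult)

lemma keys_single_times:
  "Poly_Mapping.keys (Poly_Mapping.single k c * p) \<subseteq> (+) k ` Poly_Mapping.keys p"
  using keys_mult[of "Poly_Mapping.single k c" p] by (auto split: if_splits)

lemma keys_plus_nat:
  fixes a b :: "'a \<Rightarrow>\<^sub>0 nat"
  shows "Poly_Mapping.keys (a + b) = Poly_Mapping.keys a \<union> Poly_Mapping.keys b"
  by (auto simp: in_keys_iff lookup_add)

lemma monomial_degree_superset:
  assumes "finite A" "Poly_Mapping.keys m \<subseteq> A"
  shows "monomial_degree m = (\<Sum>i\<in>A. Poly_Mapping.lookup m i)"
  unfolding monomial_degree_def using assms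
  by (intro sum.mono_neutral_left) (auto simp: in_keys_iff)

lemma monomial_degree_add: "monomial_degree (a + b) = monomial_degree a + monomial_degree b"
  using monomial_degree_superset[of "Poly_Mapping.keys a \<union> Poly_Mapping.keys b" "a + b"]
    monomial_degree_superset[of "Poly_Mapping.keys a \<union> Poly_Mapping.keys b" a]
    monomial_degree_superset[of "Poly_Mapping.keys a \<union> Poly_Mapping.keys b" b]
  by (simp add: keys_plus_nat lookup_add sum.distrib)

definition sqf_monomial :: "nat set \<Rightarrow> monomial" where
  "sqf_monomial F = (\<Sum>i\<in>F. Poly_Mapping.single i 1)"

definition sqf_poly :: "nat set \<Rightarrow> 'k::field polynomial" where
  "sqf_poly F = Poly_Mapping.single (sqf_monomial F) 1"

lemma lookup_sqf_monomial:
  "finite F \<Longrightarrow> Poly_Mapping.lookup (sqf_monomial F) i = (if i \<in> F then 1 else 0)"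
  by (simp add: sqf_monomial_def lookup_sum lookup_single when_def sum.delta')

lemma keys_sqf_monomial: "finite F \<Longrightarrow> Poly_Mapping.keys (sqf_monomial F) = F"
  by (auto simp: in_keys_iff lookup_sqf_monomial split: if_splits)

lemma monomial_degree_sqf: "finite F \<Longrightarrow> monomial_degree (sqf_monomial F) = card F"
  by (simp add: monomial_degree_def keys_sqf_monomial lookup_sqf_monomial)

lemma prod_indet: "finite F \<Longrightarrow> (\<Prod>i\<in>F. indet i) = sqf_poly F"
proof (induction F rule: finite_induct)
  case empty
  then show ?case by (simp add: sqf_poly_def sqf_monomial_def)
next
  case (insert x F)
  then show ?case by (simp add: sqf_poly_def sqf_monomial_def indet_def mult_single)
qed

lemma indet_eq_sqf_poly: "indet i = sqf_poly {i}"
  by (simp add: sqf_poly_def sqf_monomial_def indet_def)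

lemma sqf_monomial_add_diff:
  assumes "finite F" "F \<subseteq> Poly_Mapping.keys m"
  shows "sqf_monomial F + (m - sqf_monomial F) = m"
  using assms by (intro poly_mapping_eqI) (fastforce simp: lookup_add lookup_minus lookup_sqf_monomial in_keys_iff)

section \<open>The polynomial ring in n variables\<close>

abbreviation pring :: "nat \<Rightarrow> 'k::field polynomial set" where
  "pring n \<equiv> carrier (poly_ring n)"

lemma pring_iff: "p \<in> pring n \<longleftrightarrow> (\<forall>m\<in>Poly_Mapping.keys p. Poly_Mapping.keys m \<subseteq> {1..n})"
  by (simp add: poly_ring_def)

lemma keys_uminus_poly: "Poly_Mapping.keys (- p) = Poly_Mapping.keys (p :: 'a \<Rightarrow>\<^sub>0 'b::ab_group_add)"
  by (auto simp: in_keys_iff)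

lemma pring_0: "0 \<in> pring n" and pring_1: "1 \<in> pring n"
  by (simp_all add: pring_iff)

lemma pring_add: "p \<in> pring n \<Longrightarrow> q \<in> pring n \<Longrightarrow> p + q \<in> pring n"
  unfolding pring_iff using keys_add[of p q] by blast

lemma pring_uminus: "p \<in> pring n \<Longrightarrow> - p \<in> pring n"
  by (simp add: pring_iff keys_uminus_poly)

lemma pring_diff: "p \<in> pring n \<Longrightarrow> q \<in> pring n \<Longrightarrow> p - q \<in> pring n"
  using pring_add[of p n "- q"] pring_uminus[of q n] by simp

lemma pring_mult: "p \<in> pring n \<Longrightarrow> q \<in> pring n \<Longrightarrow> p * q \<in> pring n"
  unfolding pring_iff using keys_mult[of p q] by (fastforce simp: keys_plus_nat)

lemma pring_sqf: "finite F \<Longrightarrow> F \<subseteq> {1..n} \<Longrightarrow> sqf_poly F \<in> pring n"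
  by (simp add: pring_iff sqf_poly_def keys_sqf_monomial)

lemma pring_indet: "i \<in> {1..n} \<Longrightarrow> indet i \<in> pring n"
  by (simp add: indet_eq_sqf_poly pring_sqf)

lemmas pring_closed = pring_0 pring_1 pring_add pring_uminus pring_diff pring_mult

lemma poly_ring_ops:
  "p \<otimes>\<^bsub>poly_ring n\<^esub> q = p * q" "\<one>\<^bsub>poly_ring n\<^esub> = 1"
  "p \<oplus>\<^bsub>poly_ring n\<^esub> q = p + q" "\<zero>\<^bsub>poly_ring n\<^esub> = 0"
  by (simp_all add: poly_ring_def)

lemma cring_poly_ring: "cring (poly_ring n :: 'k::field polynomial ring)"
proof (rule cringI)
  show "abelian_group (poly_ring n :: 'k polynomial ring)"
  proof (rule abelian_groupI)
    fix x :: "'k polynomial" assume "x \<in> carrier (poly_ring n)"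
    then show "\<exists>y\<in>carrier (poly_ring n). y \<oplus>\<^bsub>poly_ring n\<^esub> x = \<zero>\<^bsub>poly_ring n\<^esub>"
      by (intro bexI[of _ "- x"] pring_uminus) (simp_all add: poly_ring_ops)
  qed (simp_all add: poly_ring_ops pring_closed add.assoc add.commute)
  show "comm_monoid (poly_ring n :: 'k polynomial ring)"
    by (rule comm_monoidI)
      (simp_all add: poly_ring_ops pring_closed mult.assoc mult.commute)
qed (simp add: poly_ring_ops distrib_right)

text \<open>Division by x_F: the terms of \<open>f\<close> divisible by x_F are collected in
  \<open>sqf_poly F * p\<close>, the others in \<open>t\<close>. Since \<open>t\<close> uses only
  monomials of \<open>f\<close>, it inherits every condition imposed monomial by monomial; both
  ideal descriptions below rely on this when a generator is split off.\<close>

lemma sqf_poly_split: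
  fixes f :: "'k::field polynomial"
  assumes "f \<in> pring n" "finite F"
  obtains p t where "p \<in> pring n" "f = t + sqf_poly F * p"
    "Poly_Mapping.keys t \<subseteq> {m \<in> Poly_Mapping.keys f. \<not> F \<subseteq> Poly_Mapping.keys m}"
proof -
  define p where "p = Poly_Mapping.map_key ((+) (sqf_monomial F)) f"
  have lp: "Poly_Mapping.lookup p m = Poly_Mapping.lookup f (sqf_monomial F + m)" for m
    by (simp add: p_def map_key.rep_eq)
  define t where "t = f - sqf_poly F * p"
  have "p \<in> pring n"
    unfolding pring_iff
  proof
    fix m assume "m \<in> Poly_Mapping.keys p"
    then have "sqf_monomial F + m \<in> Poly_Mapping.keys f"
      by (simp add: in_keys_iff lp)
    then have "Poly_Mapping.keys (sqf_monomial F + m) \<subseteq> {1..n}"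
      using assms(1) unfolding pring_iff by blast
    then show "Poly_Mapping.keys m \<subseteq> {1..n}"
      by (simp add: keys_plus_nat)
  qed
  moreover have "Poly_Mapping.lookup t m = 0" if "F \<subseteq> Poly_Mapping.keys m" for m
    using lookup_single_times[of "sqf_monomial F" p "m - sqf_monomial F"]
      sqf_monomial_add_diff[OF assms(2) that]
    by (simp add: t_def lookup_minus sqf_poly_def lp)
  moreover have "Poly_Mapping.lookup t m = Poly_Mapping.lookup f m"
    if "\<not> F \<subseteq> Poly_Mapping.keys m" for m
  proof -
    have "m \<notin> Poly_Mapping.keys (sqf_poly F * p)"
      using keys_single_times[of "sqf_monomial F" 1 p] that keys_sqf_monomial[OF assms(2)]
      unfolding sqf_poly_def by (auto simp: keys_plus_nat)
    then show ?thesis by (simp add: t_def lookup_minus in_keys_iff)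
  qed
  ultimately have "Poly_Mapping.keys t \<subseteq> {m \<in> Poly_Mapping.keys f. \<not> F \<subseteq> Poly_Mapping.keys m}"
    by (metis (no_types, lifting) in_keys_iff mem_Collect_eq subsetI)
  then show ?thesis
    using that[of p t] \<open>p \<in> pring n\<close> by (simp add: t_def)
qed

section \<open>Homogeneous components\<close>

definition homogeneous :: "nat \<Rightarrow> 'k::field polynomial \<Rightarrow> bool" where
  "homogeneous q p \<longleftrightarrow> (\<forall>m\<in>Poly_Mapping.keys p. monomial_degree m = q)"

definition hom_part :: "nat \<Rightarrow> 'k::field polynomial \<Rightarrow> 'k polynomial" where
  "hom_part q p = Poly_Mapping.mapp (\<lambda>m c. c when monomial_degree m = q) p"

lemma lookup_hom_part:
  "Poly_Mapping.lookup (hom_part q p) m = (Poly_Mapping.lookup p m when monomial_degree m = q)"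
  by (auto simp: hom_part_def lookup_mapp when_def in_keys_iff)

lemma homogeneous_hom_part: "homogeneous q (hom_part q p)"
  by (auto simp: homogeneous_def in_keys_iff lookup_hom_part)

lemma hom_part_pring: "p \<in> pring n \<Longrightarrow> hom_part q p \<in> pring n"
  by (auto simp: pring_iff in_keys_iff lookup_hom_part)

lemma hom_part_add: "hom_part q (p + r) = hom_part q p + hom_part q r"
  by (rule poly_mapping_eqI) (simp add: lookup_hom_part lookup_add when_def)

lemma hom_part_sum: "hom_part q (sum f A) = (\<Sum>x\<in>A. hom_part q (f x))"
proof (induction A rule: infinite_finite_induct)
qed (simp_all add: hom_part_add, simp_all add: hom_part_def mapp_def)

lemma hom_part_homogeneous: "homogeneous q p \<Longrightarrow> hom_part q p = p"
  by (rule poly_mapping_eqI) (auto simp: lookup_hom_part homogeneous_def in_keys_iff when_def)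

lemma hom_part_eq_0: "(\<And>m. m \<in> Poly_Mapping.keys p \<Longrightarrow> monomial_degree m \<noteq> q) \<Longrightarrow> hom_part q p = 0"
  by (rule poly_mapping_eqI) (auto simp: lookup_hom_part in_keys_iff when_def)

lemma homogeneous_mult: "homogeneous a p \<Longrightarrow> homogeneous b r \<Longrightarrow> homogeneous (a + b) (p * r)"
  unfolding homogeneous_def using keys_mult[of p r] by (fastforce simp: monomial_degree_add)

text \<open>Multiplication by \<open>r\<close> raises every degree by exactly \<open>b\<close>, so
  the terms of \<open>p\<close> outside degree \<open>a\<close> contribute nothing in degree
  \<open>a + b\<close>.\<close>

lemma hom_part_mult:
  assumes "homogeneous b r"
  shows "hom_part (a + b) (p * r) = hom_part a p * r"
proof -
  define s where "s = p - hom_part a p"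
  have s: "monomial_degree m \<noteq> a" if "m \<in> Poly_Mapping.keys s" for m
    using that by (auto simp: s_def in_keys_iff lookup_minus lookup_hom_part)
  have "hom_part (a + b) (s * r) = 0"
  proof (rule hom_part_eq_0)
    fix m assume "m \<in> Poly_Mapping.keys (s * r)"
    then obtain x y where "m = x + y" "x \<in> Poly_Mapping.keys s" "y \<in> Poly_Mapping.keys r"
      using keys_mult[of s r] by blast
    then show "monomial_degree m \<noteq> a + b"
      using s assms by (simp add: monomial_degree_add homogeneous_def)
  qed
  moreover have "p * r = hom_part a p * r + s * r"
    by (simp add: s_def algebra_simps)
  ultimately show ?thesis
    using hom_part_homogeneous[OF homogeneous_mult[OF homogeneous_hom_part assms]]
    by (simp add: hom_part_add)
qed

lemma homogeneous_0: "homogeneous q 0"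
  by (simp add: homogeneous_def)

lemma homogeneous_uminus: "homogeneous q p \<Longrightarrow> homogeneous q (- p)"
  by (simp add: homogeneous_def keys_uminus_poly)

lemma homogeneous_sqf: "finite F \<Longrightarrow> homogeneous (card F) (sqf_poly F)"
  by (simp add: homogeneous_def sqf_poly_def monomial_degree_sqf)

lemma homogeneous_indet: "homogeneous 1 (indet i)"
  using homogeneous_sqf[of "{i}"] by (simp add: indet_eq_sqf_poly)

section \<open>Syzygies of sequences with linear quotients\<close>

text \<open>The ideal generated by the variables with index in \<open>X\<close>, by the monomial membership
  criterion; likewise \<open>mon_ideal\<close> below for squarefree monomials.\<close>

definition var_ideal :: "nat \<Rightarrow> nat set \<Rightarrow> 'k::field polynomial set" where
  "var_ideal n X = {p \<in> pring n. \<forall>m\<in>Poly_Mapping.keys p. Poly_Mapping.keys m \<inter> X \<noteq> {}}"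

lemma var_ideal_empty: "p \<in> var_ideal n {} \<longleftrightarrow> p = 0"
  by (auto simp: var_ideal_def pring_0)

lemma var_ideal_mono: "X \<subseteq> Y \<Longrightarrow> p \<in> var_ideal n X \<Longrightarrow> p \<in> var_ideal n Y"
  unfolding var_ideal_def by blast

lemma var_ideal_add: "p \<in> var_ideal n X \<Longrightarrow> r \<in> var_ideal n X \<Longrightarrow> p + r \<in> var_ideal n X"
  unfolding var_ideal_def using keys_add[of p r] pring_add[of p n r] by blast

lemma var_ideal_mult:
  assumes "p \<in> var_ideal n X" "r \<in> pring n"
  shows "r * p \<in> var_ideal n X"
proof -
  have "Poly_Mapping.keys m \<inter> X \<noteq> {}" if m: "m \<in> Poly_Mapping.keys (r * p)" for m
  proof -
    obtain a b where "m = a + b" "b \<in> Poly_Mapping.keys p"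
      using m keys_mult[of r p] by blast
    then show ?thesis using assms(1) by (auto simp: var_ideal_def keys_plus_nat)
  qed
  then show ?thesis using assms by (simp add: var_ideal_def pring_mult)
qed

lemma indet_in_var_ideal: "i \<in> X \<Longrightarrow> i \<in> {1..n} \<Longrightarrow> indet i \<in> var_ideal n X"
  using pring_indet[of i n] by (simp add: var_ideal_def indet_def)

text \<open>A variable outside \<open>X\<close> is a nonzerodivisor modulo the ideal of
  \<open>X\<close>: an element of \<open>X\<close> in the support of x_i m must already be in the
  support of m. This computes the colon ideals between the lifted syzygies.\<close>

lemma var_ideal_indet_mult_iff:
  assumes "i \<notin> X" "i \<in> {1..n}" "p \<in> pring n"
  shows "indet i * p \<in> var_ideal n X \<longleftrightarrow> p \<in> var_ideal n X"
proof
  assume *: "indet i * p \<in> var_ideal n X"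
  have "Poly_Mapping.keys m \<inter> X \<noteq> {}" if "m \<in> Poly_Mapping.keys p" for m
  proof -
    have "Poly_Mapping.single i 1 + m \<in> Poly_Mapping.keys (indet i * p)"
      using that lookup_single_times[of "Poly_Mapping.single i 1" p m]
      unfolding in_keys_iff indet_def by simp
    then have "Poly_Mapping.keys (Poly_Mapping.single i (1::nat) + m) \<inter> X \<noteq> {}"
      using * unfolding var_ideal_def by blast
    then show ?thesis using assms(1) by (simp add: keys_plus_nat)
  qed
  then show "p \<in> var_ideal n X" using assms(3) by (simp add: var_ideal_def)
qed (simp add: var_ideal_mult pring_indet[OF assms(2)])

lemma var_ideal_insert_split:
  fixes p :: "'k::field polynomial"
  assumes "p \<in> var_ideal n (insert i X)"
  obtains t r where "t \<in> var_ideal n X" "r \<in> pring n" "p = t + indet i * r"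
proof -
  have p: "p \<in> pring n" using assms by (simp add: var_ideal_def)
  obtain r t where *: "r \<in> pring n" "p = t + sqf_poly {i} * r"
    "Poly_Mapping.keys t \<subseteq> {m \<in> Poly_Mapping.keys p. \<not> {i} \<subseteq> Poly_Mapping.keys m}"
    using sqf_poly_split[OF p, of "{i}"] by blast
  have "t \<in> var_ideal n X"
    unfolding var_ideal_def pring_iff mem_Collect_eq
  proof (intro conjI ballI)
    fix m assume "m \<in> Poly_Mapping.keys t"
    then have "m \<in> Poly_Mapping.keys p" "i \<notin> Poly_Mapping.keys m" using *(3) by auto
    then show "Poly_Mapping.keys m \<subseteq> {1..n}" "Poly_Mapping.keys m \<inter> X \<noteq> {}"
      using assms unfolding var_ideal_def pring_iff by blast+
  qed
  then show ?thesis using that * by (simp add: indet_eq_sqf_poly)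
qed

text \<open>A vector of a free module of rank \<open>r\<close> is a function that vanishes from index \<open>r\<close> on, so
  that modules of all ranks share one type and vectors need no padding when the rank grows.\<close>

definition comb :: "(nat \<Rightarrow> 'k::field polynomial) list \<Rightarrow> (nat \<Rightarrow> 'k polynomial) \<Rightarrow> nat \<Rightarrow> 'k polynomial" where
  "comb us s c = (\<Sum>l<length us. s l * (us ! l) c)"

definition pspan :: "nat \<Rightarrow> (nat \<Rightarrow> 'k::field polynomial) list \<Rightarrow> (nat \<Rightarrow> 'k polynomial) set" where
  "pspan n us = {comb us s | s. \<forall>l. s l \<in> pring n}"

definition syzygies :: "nat \<Rightarrow> (nat \<Rightarrow> 'k::field polynomial) list \<Rightarrow> (nat \<Rightarrow> 'k polynomial) set" where
  "syzygies n us = {w. (\<forall>c. w c \<in> pring n) \<and> (\<forall>c\<ge>length us. w c = 0) \<and> (\<forall>c. comb us w c = 0)}"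

lemma comb_snoc: "comb (us @ [u]) s c = comb us s c + s (length us) * u c"
  by (simp add: comb_def nth_append)

lemma comb_cong: "(\<And>l. l < length us \<Longrightarrow> s l = t l) \<Longrightarrow> comb us s c = comb us t c"
  by (simp add: comb_def)

lemma comb_add: "comb us (\<lambda>l. s l + t l) c = comb us s c + comb us t c"
  by (simp add: comb_def distrib_right sum.distrib)

lemma comb_mult: "comb us (\<lambda>l. p * s l) c = p * comb us s c"
  by (simp add: comb_def sum_distrib_left mult.assoc)

lemma comb_uminus: "comb us (\<lambda>l. - s l) c = - comb us s c"
  using comb_mult[of us "-1" s c] by simp

lemma pspan_snoc:
  "pspan n (us @ [u]) = {\<lambda>c. w c + p * u c | w p. w \<in> pspan n us \<and> p \<in> pring n}" (is "?L = ?R")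
proof
  show "?L \<subseteq> ?R"
  proof
    fix x assume "x \<in> ?L"
    then obtain s where s: "x = comb (us @ [u]) s" "\<forall>l. s l \<in> pring n"
      by (auto simp: pspan_def)
    then have "x = (\<lambda>c. comb us s c + s (length us) * u c)"
      by (auto simp: comb_snoc)
    then show "x \<in> ?R" using s(2) by (fastforce simp: pspan_def)
  qed
next
  show "?R \<subseteq> ?L"
  proof
    fix x assume "x \<in> ?R"
    then obtain s p where s: "x = (\<lambda>c. comb us s c + p * u c)" "\<forall>l. s l \<in> pring n" "p \<in> pring n"
      by (auto simp: pspan_def)
    define t where "t = s(length us := p)"
    have "x = comb (us @ [u]) t"
      using comb_cong[of us s t] by (auto simp: s(1) comb_snoc t_def)
    moreover have "\<forall>l. t l \<in> pring n" using s by (simp add: t_def)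
    ultimately show "x \<in> ?L" by (auto simp: pspan_def)
  qed
qed

lemma pspan_0: "(\<lambda>c. 0) \<in> pspan n us"
proof -
  have "(\<lambda>c. 0) = comb us (\<lambda>l. 0)" by (auto simp: comb_def)
  then show ?thesis
    unfolding pspan_def mem_Collect_eq by (intro exI[of _ "\<lambda>l. 0"] conjI allI pring_0)
qed

lemma pspan_Nil: "pspan n [] = {\<lambda>c. 0}"
  using pspan_0[of n "[]"] by (auto simp: pspan_def comb_def)

lemma member_pspan: "u \<in> set us \<Longrightarrow> u \<in> pspan n us"
proof (induction us rule: rev_induct)
  case (snoc v us)
  show ?case
  proof (cases "u = v")
    case True
    have "u = (\<lambda>c. 0 + 1 * v c)" by (simp add: True)
    then show ?thesis unfolding pspan_snoc using pspan_0 pring_1 by fast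
  next
    case False
    then have "u \<in> pspan n us" using snoc by simp
    moreover have "u = (\<lambda>c. u c + 0 * v c)" by simp
    ultimately show ?thesis unfolding pspan_snoc using pring_0 by fast
  qed
qed simp

lemma syzygies_add:
  "w \<in> syzygies n us \<Longrightarrow> x \<in> syzygies n us \<Longrightarrow> (\<lambda>c. w c + x c) \<in> syzygies n us"
  by (simp add: syzygies_def comb_add pring_add)

lemma syzygies_mult:
  "w \<in> syzygies n us \<Longrightarrow> p \<in> pring n \<Longrightarrow> (\<lambda>c. p * w c) \<in> syzygies n us"
  by (simp add: syzygies_def comb_mult pring_mult)

text \<open>The last premise of \<open>snoc\<close> says that the colon ideal of the earlier span by
  \<open>u\<close> is generated by the variables in \<open>X\<close>. Such an ideal never contains
  1, so no vector lies in the span of its predecessors. All entries share the degree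
  \<open>q\<close>, which is why the resolution is linear and not merely graded.\<close>

inductive linear_quotients :: "nat \<Rightarrow> nat \<Rightarrow> (nat \<Rightarrow> 'k::field polynomial) list \<Rightarrow> bool" for n q where
  Nil: "linear_quotients n q []"
| snoc: "\<lbrakk>linear_quotients n q us; \<forall>c. u c \<in> pring n \<and> homogeneous q (u c); X \<subseteq> {1..n};
    \<forall>p\<in>pring n. (\<lambda>c. p * u c) \<in> pspan n us \<longleftrightarrow> p \<in> var_ideal n X\<rbrakk>
    \<Longrightarrow> linear_quotients n q (us @ [u])"

lemma linear_quotients_member:
  "linear_quotients n q us \<Longrightarrow> u \<in> set us \<Longrightarrow> u c \<in> pring n \<and> homogeneous q (u c)"
  by (induction rule: linear_quotients.induct) auto

text \<open>Replacing arbitrary coefficients by their components of degree \<open>a\<close> does not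
  change the combination, because the other components contribute only in degrees where
  \<open>w\<close> has nothing.\<close>

lemma homogeneous_coefficients:
  assumes "\<forall>u\<in>set us. \<forall>c. homogeneous q (u c)"
    and "w \<in> pspan n us" "\<And>c. homogeneous (a + q) (w c)"
  obtains s where "\<And>l. s l \<in> pring n" "\<And>l. homogeneous a (s l)" "w = comb us s"
proof -
  obtain s where s: "\<forall>l. s l \<in> pring n" "w = comb us s"
    using assms(2) by (auto simp: pspan_def)
  have "w c = comb us (\<lambda>l. hom_part a (s l)) c" for c
  proof -
    have "w c = hom_part (a + q) (comb us s c)"
      using hom_part_homogeneous[OF assms(3)] s(2) by simp
    also have "\<dots> = comb us (\<lambda>l. hom_part a (s l)) c"
      unfolding comb_def hom_part_sum
      using assms(1) by (intro sum.cong refl hom_part_mult) simp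
    finally show ?thesis .
  qed
  then show ?thesis
    using that[of "\<lambda>l. hom_part a (s l)"] s(1) by (auto simp: hom_part_pring homogeneous_hom_part)
qed

text \<open>The generators \<open>x\<^sub>i\<close>, \<open>i \<in> X\<close>, of the last colon ideal are lifted to syzygies one
  at a time; the colon ideals between these lifts are those of the sequence of the \<open>x\<^sub>i\<close>.\<close>

lemma linear_quotients_syzygies_snoc:
  fixes us :: "(nat \<Rightarrow> 'k::field polynomial) list"
  assumes us: "\<forall>v\<in>set us. \<forall>c. homogeneous q (v c)"
    and u: "\<forall>c. u c \<in> pring n \<and> homogeneous q (u c)" and X: "X \<subseteq> {1..n}"
    and colon: "\<forall>p\<in>pring n. (\<lambda>c. p * u c) \<in> pspan n us \<longleftrightarrow> p \<in> var_ideal n X"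
    and ws: "linear_quotients n 1 ws" "pspan n ws = syzygies n us"
    and Y: "Y \<subseteq> X"
  shows "\<exists>vs. linear_quotients n 1 vs \<and>
    pspan n vs = {w \<in> syzygies n (us @ [u]). w (length us) \<in> var_ideal n Y}"
proof -
  have "finite Y" using finite_subset[OF subset_trans[OF Y X]] by simp
  let ?m = "length us"
  show ?thesis using \<open>finite Y\<close> Y
  proof (induction Y rule: finite_induct)
    case empty
    \<comment> \<open>A vanishing last coordinate makes a syzygy of the extended list a syzygy of
      \<open>us\<close>, so the induction starts from the generators \<open>ws\<close>.\<close>
    have "syzygies n us = {w \<in> syzygies n (us @ [u]). w ?m \<in> var_ideal n {}}"
      by (auto simp: syzygies_def comb_snoc var_ideal_empty) (metis Suc_leI le_neq_implies_less)
    then show ?case using ws by auto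
  next
    case (insert i Y)
    then obtain vs where vs: "linear_quotients n 1 vs"
      "pspan n vs = {w \<in> syzygies n (us @ [u]). w ?m \<in> var_ideal n Y}" by auto
    have i: "i \<in> X" "i \<in> {1..n}" using insert.prems X by auto
    have ui: "(\<lambda>c. indet i * u c) \<in> pspan n us"
      using colon pring_indet[OF i(2)] indet_in_var_ideal[OF i] by blast
    have hom: "homogeneous (1 + q) (indet i * u c)" for c
      using u by (intro homogeneous_mult homogeneous_indet) blast
    obtain s where s: "\<And>l. s l \<in> pring n" "\<And>l. homogeneous 1 (s l)" "(\<lambda>c. indet i * u c) = comb us s"
      by (rule homogeneous_coefficients[OF us ui, of 1])
        (use hom in auto)
    \<comment> \<open>\<open>v\<close> records the relation x_i u = sum of s_l u_l; its last
      coordinate is x_i, and the choice of \<open>s\<close> in degree 1 makes all its entries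
      linear.\<close>
    define v where "v = (\<lambda>c. if c < ?m then - s c else if c = ?m then indet i else 0)"
    have vm: "v ?m = indet i" by (simp add: v_def)
    have vp: "v c \<in> pring n \<and> homogeneous 1 (v c)" for c
      using s pring_indet[OF i(2), where 'a='k]
      by (simp add: v_def pring_uminus homogeneous_uminus homogeneous_indet[unfolded One_nat_def] homogeneous_0 pring_0)
    have "comb (us @ [u]) v c = 0" for c
    proof -
      have "comb us v c = - comb us s c"
        using comb_cong[of us v "\<lambda>l. - s l" c] by (simp add: v_def comb_uminus)
      then show ?thesis
        using fun_cong[OF s(3), of c] by (simp add: comb_snoc vm)
    qed
    moreover have "\<forall>c\<ge>length (us @ [u]). v c = 0" by (simp add: v_def)
    ultimately have v: "v \<in> syzygies n (us @ [u])"
      using vp unfolding syzygies_def by blast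
    have "linear_quotients n 1 (vs @ [v])"
    proof (rule linear_quotients.snoc[OF vs(1)])
      \<comment> \<open>Membership in the span of \<open>vs\<close> is decided by the last
        coordinate p x_i, and x_i can be cancelled modulo the ideal of \<open>Y\<close> because i is
        not in \<open>Y\<close>.\<close>
      show "\<forall>p\<in>pring n. (\<lambda>c. p * v c) \<in> pspan n vs \<longleftrightarrow> p \<in> var_ideal n Y"
        using syzygies_mult[OF v] var_ideal_indet_mult_iff[OF insert.hyps(2) i(2)]
        by (auto simp: vs(2) vm mult.commute)
    qed (use vp insert.prems X in auto)
    moreover have "pspan n (vs @ [v]) =
      {w \<in> syzygies n (us @ [u]). w ?m \<in> var_ideal n (insert i Y)}" (is "_ = ?R")
    proof
      show "pspan n (vs @ [v]) \<subseteq> ?R"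
        unfolding pspan_snoc vs(2)
        using v vm i(2) indet_in_var_ideal[of i "insert i Y" n] var_ideal_mono[of Y "insert i Y" _ n]
        by (auto intro!: syzygies_add syzygies_mult var_ideal_add var_ideal_mult)
    next
      show "?R \<subseteq> pspan n (vs @ [v])"
      proof
        fix w assume "w \<in> ?R"
        then have w: "w \<in> syzygies n (us @ [u])" "w ?m \<in> var_ideal n (insert i Y)" by auto
        obtain t r where r: "t \<in> var_ideal n Y" "r \<in> pring n" "w ?m = t + indet i * r"
          using var_ideal_insert_split[OF w(2)] by blast
        \<comment> \<open>Subtracting r v removes the multiple of x_i from the last coordinate and
          leaves a syzygy covered by the induction hypothesis.\<close>
        define x where "x = (\<lambda>c. w c + (- r) * v c)"
        have "x \<in> syzygies n (us @ [u])"
          unfolding x_def using r(2) by (intro syzygies_add w syzygies_mult v pring_uminus)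
        moreover have "x ?m = t" by (simp add: x_def vm r(3))
        ultimately have "x \<in> pspan n vs" using vs(2) r(1) by simp
        moreover have "w = (\<lambda>c. x c + r * v c)" by (simp add: x_def)
        ultimately show "w \<in> pspan n (vs @ [v])" unfolding pspan_snoc using r(2) by blast
      qed
    qed
    ultimately show ?case by blast
  qed
qed

theorem linear_quotients_syzygies:
  "linear_quotients n q us \<Longrightarrow> \<exists>ws. linear_quotients n 1 ws \<and> pspan n ws = syzygies n us"
proof (induction rule: linear_quotients.induct)
  case Nil
  have "syzygies n [] = {\<lambda>c. 0}"
    by (auto simp: syzygies_def comb_def pring_0)
  then show ?case using linear_quotients.Nil pspan_Nil by metis
next
  case (snoc us u X)
  then obtain ws where ws: "linear_quotients n 1 ws" "pspan n ws = syzygies n us" by blast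
  \<comment> \<open>The last coordinate of any syzygy multiplies \<open>u\<close> into the span of
    \<open>us\<close>, hence lies in the colon ideal. Taking \<open>Y\<close> to be all of
    \<open>X\<close> in the preceding lemma therefore imposes no restriction.\<close>
  have "w (length us) \<in> var_ideal n X" if w: "w \<in> syzygies n (us @ [u])" for w
  proof -
    have "comb us w c + w (length us) * u c = 0" for c
      using w by (simp add: syzygies_def comb_snoc)
    then have "(\<lambda>c. w (length us) * u c) = comb us (\<lambda>l. - w l)"
      by (auto simp: comb_uminus eq_neg_iff_add_eq_0 add.commute)
    then have "(\<lambda>c. w (length us) * u c) \<in> pspan n us"
      using w by (auto simp: pspan_def syzygies_def intro!: exI[of _ "\<lambda>l. - w l"] pring_uminus)
    then show ?thesis using snoc.hyps(4) w by (auto simp: syzygies_def)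
  qed
  then have eq: "{w \<in> syzygies n (us @ [u]). w (length us) \<in> var_ideal n X} = syzygies n (us @ [u])"
    by blast
  have "\<forall>v\<in>set us. \<forall>c. homogeneous q (v c)"
    using linear_quotients_member[OF snoc.hyps(1)] by blast
  from linear_quotients_syzygies_snoc[OF this snoc.hyps(2-4) ws subset_refl]
  show ?case unfolding eq .
qed

section \<open>Matrices of the resolution\<close>

lemma homogeneous_constant_term: "homogeneous (Suc q) p \<Longrightarrow> Poly_Mapping.lookup p 0 = 0"
proof (rule ccontr)
  assume "homogeneous (Suc q) p" "Poly_Mapping.lookup p 0 \<noteq> 0"
  then have "monomial_degree 0 = Suc q" by (simp add: homogeneous_def in_keys_iff)
  then show False by (simp add: monomial_degree_def)
qed

definition fun_of_vec :: "'k::field polynomial vec \<Rightarrow> nat \<Rightarrow> 'k polynomial" where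
  "fun_of_vec v = (\<lambda>c. if c < dim_vec v then v $ c else 0)"

definition mat_of_gens :: "nat \<Rightarrow> (nat \<Rightarrow> 'k::field polynomial) list \<Rightarrow> 'k polynomial mat" where
  "mat_of_gens r us = mat r (length us) (\<lambda>(c, j). (us ! j) c)"

lemma mat_of_gens_mult:
  assumes "v \<in> carrier_vec (length us)" "c < r"
  shows "(mat_of_gens r us *\<^sub>v v) $ c = comb us (fun_of_vec v) c"
  using assms
  by (auto simp: mat_of_gens_def scalar_prod_def comb_def fun_of_vec_def mult.commute atLeast0LessThan intro!: sum.cong)

lemma fun_of_vec_pring: "v \<in> free_module n r \<Longrightarrow> fun_of_vec v c \<in> pring n"
  by (auto simp: free_module_def fun_of_vec_def pring_0)

lemma vec_free_module: "(\<And>l. s l \<in> pring n) \<Longrightarrow> vec r s \<in> free_module n r"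
  by (simp add: free_module_def)

lemma comb_vec: "comb us (fun_of_vec (vec (length us) s)) c = comb us s c"
  by (rule comb_cong) (simp add: fun_of_vec_def)

text \<open>This is exactness at one spot of the resolution, with the generators of the syzygies as
  columns of the next matrix. Passing from functions to vectors of dimension
  \<open>length us\<close> loses nothing, since syzygies vanish from that index on.\<close>

lemma syzygies_eq_image:
  assumes "pspan n ws = syzygies n us"
  shows "{v \<in> free_module n (length us). \<forall>c. comb us (fun_of_vec v) c = 0} =
    (\<lambda>w. mat_of_gens (length us) ws *\<^sub>v w) ` free_module n (length ws)" (is "?L = ?R")
proof
  show "?L \<subseteq> ?R"
  proof
    fix v assume v: "v \<in> ?L"
    then have d: "dim_vec v = length us" by (auto simp: free_module_def)
    then have "fun_of_vec v \<in> syzygies n us"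
      using v fun_of_vec_pring by (auto simp: syzygies_def) (simp add: fun_of_vec_def)
    then obtain s where s: "fun_of_vec v = comb ws s" "\<forall>l. s l \<in> pring n"
      unfolding assms[symmetric] by (auto simp: pspan_def)
    have "v = mat_of_gens (length us) ws *\<^sub>v vec (length ws) s"
    proof (rule eq_vecI)
      fix c assume "c < dim_vec (mat_of_gens (length us) ws *\<^sub>v vec (length ws) s)"
      then have c: "c < length us" by (simp add: mat_of_gens_def)
      have "v $ c = fun_of_vec v c" using c d by (simp add: fun_of_vec_def)
      then show "v $ c = (mat_of_gens (length us) ws *\<^sub>v vec (length ws) s) $ c"
        using c by (simp add: mat_of_gens_mult s(1) comb_vec)
    qed (simp add: d mat_of_gens_def)
    then show "v \<in> ?R" using vec_free_module s(2) by blast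
  qed
  show "?R \<subseteq> ?L"
  proof
    fix v assume "v \<in> ?R"
    then obtain w where w: "v = mat_of_gens (length us) ws *\<^sub>v w" "w \<in> free_module n (length ws)"
      by blast
    have d: "dim_vec v = length us" by (simp add: w(1) mat_of_gens_def)
    have wc: "w \<in> carrier_vec (length ws)" using w(2) by (simp add: free_module_def)
    have "comb ws (fun_of_vec w) \<in> pspan n ws"
      using fun_of_vec_pring[OF w(2)] by (auto simp: pspan_def)
    then have *: "comb ws (fun_of_vec w) \<in> syzygies n us" by (simp add: assms)
    have "fun_of_vec v = comb ws (fun_of_vec w)"
    proof
      fix c show "fun_of_vec v c = comb ws (fun_of_vec w) c"
        using * mat_of_gens_mult[OF wc, of c "length us"]
        by (cases "c < length us") (auto simp: fun_of_vec_def[of v] d w(1)[symmetric] syzygies_def)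
    qed
    then have "fun_of_vec v \<in> syzygies n us" using * by simp
    moreover from this have "v $ c \<in> pring n" if "c < length us" for c
    proof -
      have "fun_of_vec v c \<in> pring n" using \<open>fun_of_vec v \<in> syzygies n us\<close> by (simp add: syzygies_def)
      then show ?thesis using that d by (simp add: fun_of_vec_def)
    qed
    ultimately have "v \<in> free_module n (length us)"
      using carrier_vecI[OF d] by (simp add: free_module_def)
    then show "v \<in> ?L" using \<open>fun_of_vec v \<in> syzygies n us\<close> by (simp add: syzygies_def)
  qed
qed

lemma linear_quotients_resolution:
  assumes "linear_quotients n q us"
  obtains U where "U 0 = us" "\<And>i. linear_quotients n 1 (U (Suc i))"
    "\<And>i. pspan n (U (Suc i)) = syzygies n (U i)"
proof -
  \<comment> \<open>Only the given list has generators of degree \<open>q\<close>; every later one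
    has degree 1. Hence the invariant distinguishes index 0.\<close>
  have "\<exists>U. \<forall>i. (if i = 0 then U i = us else linear_quotients n 1 (U i)) \<and>
      pspan n (U (Suc i)) = syzygies n (U i)"
  proof (rule dependent_nat_choice)
    fix x and i :: nat assume "if i = 0 then x = us else linear_quotients n 1 x"
    then have "\<exists>q. linear_quotients n q x" using assms by (auto split: if_splits)
    then show "\<exists>y. (if Suc i = 0 then y = us else linear_quotients n 1 y) \<and> pspan n y = syzygies n x"
      using linear_quotients_syzygies by auto
  qed simp
  then obtain U where U: "\<And>i. (if i = 0 then U i = us else linear_quotients n 1 (U i)) \<and>
      pspan n (U (Suc i)) = syzygies n (U i)" by blast
  show ?thesis
  proof (rule that[of U])
    show "U 0 = us" using U[of 0] by simp
    show "linear_quotients n 1 (U (Suc i))" for i using U[of "Suc i"] by simp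
    show "pspan n (U (Suc i)) = syzygies n (U i)" for i using U by blast
  qed
qed

text \<open>The assumption \<open>rank1\<close> makes the vectors of \<open>us\<close> polynomials
  placed in coordinate 0, so their span is an ideal. Each later matrix has linear entries, which
  puts the i-th basis in degree \<open>q + i\<close> and excludes constant terms, giving
  minimality.\<close>

theorem linear_quotients_imp_linear_resolution:
  fixes us :: "(nat \<Rightarrow> 'k::field polynomial) list"
  assumes us: "linear_quotients n q us" and rank1: "\<forall>u\<in>set us. \<forall>c>0. u c = 0"
  shows "has_linear_resolution n ((\<lambda>w. w 0) ` pspan n us)"
proof -
  obtain U where U0: "U 0 = us" and U: "\<And>i. linear_quotients n 1 (U (Suc i))"
    "\<And>i. pspan n (U (Suc i)) = syzygies n (U i)"
    using linear_quotients_resolution[OF us] by blast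
  define b where "b i = length (U i)" for i
  define M where "M i = mat_of_gens (b i) (U (Suc i))" for i
  define g where "g = vec (b 0) (\<lambda>j. (us ! j) 0)"
  \<comment> \<open>The rows cut off when a list is turned into a matrix are zero, so vanishing of
    the matrix product is vanishing in all coordinates.\<close>
  have support: "u c = 0" if "u \<in> set (U (Suc i))" "c \<ge> b i" for u c i
    using member_pspan[OF that(1), of n] that(2) by (simp add: U(2) syzygies_def b_def)
  have entry: "M i $$ (r, c) = (U (Suc i) ! c) r" if "r < b i" "c < b (Suc i)" for i r c
    using that by (simp add: M_def mat_of_gens_def b_def)
  have entry_prop: "M i $$ (r, c) \<in> pring n \<and> homogeneous 1 (M i $$ (r, c))"
    if "r < b i" "c < b (Suc i)" for i r c
    using linear_quotients_member[OF U(1) nth_mem] that unfolding entry[OF that] b_def by blast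
  have g_entry: "g $ j \<in> pring n \<and> homogeneous q (g $ j)" if "j < b 0" for j
    using linear_quotients_member[OF us nth_mem] that by (simp add: g_def b_def U0)
  have g_prod: "g \<bullet> v = comb us (fun_of_vec v) 0" if "v \<in> free_module n (b 0)" for v
    using that by (auto simp: scalar_prod_def g_def b_def U0 comb_def free_module_def fun_of_vec_def
        mult.commute atLeast0LessThan intro!: sum.cong)
  have image: "(\<lambda>v. g \<bullet> v) ` free_module n (b 0) = (\<lambda>w. w 0) ` pspan n us"
  proof
    show "(\<lambda>v. g \<bullet> v) ` free_module n (b 0) \<subseteq> (\<lambda>w. w 0) ` pspan n us"
      using fun_of_vec_pring by (fastforce simp: g_prod pspan_def)
    show "(\<lambda>w. w 0) ` pspan n us \<subseteq> (\<lambda>v. g \<bullet> v) ` free_module n (b 0)"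
    proof
      fix x assume "x \<in> (\<lambda>w. w 0) ` pspan n us"
      then obtain s where s: "x = comb us s 0" "\<forall>l. s l \<in> pring n" by (auto simp: pspan_def)
      have f: "vec (b 0) s \<in> free_module n (b 0)" using s(2) by (intro vec_free_module) blast
      then have "g \<bullet> vec (b 0) s = x"
        using comb_vec[of us s 0] by (simp add: g_prod s(1) b_def U0)
      then show "x \<in> (\<lambda>v. g \<bullet> v) ` free_module n (b 0)" using f by blast
    qed
  qed
  have kernel0: "{v \<in> free_module n (b 0). g \<bullet> v = 0} = (\<lambda>w. M 0 *\<^sub>v w) ` free_module n (b 1)"
  proof -
    have "comb us s c = 0" if "c > 0" for s c
      using rank1 that by (auto simp: comb_def intro!: sum.neutral)
    then have "(\<forall>c. comb us s c = 0) \<longleftrightarrow> comb us s 0 = 0" for s by (metis gr0I)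
    then have "{v \<in> free_module n (b 0). g \<bullet> v = 0} =
        {v \<in> free_module n (length (U 0)). \<forall>c. comb (U 0) (fun_of_vec v) c = 0}"
      using g_prod by (auto simp: U0 b_def)
    also have "\<dots> = (\<lambda>w. M 0 *\<^sub>v w) ` free_module n (b 1)"
      using syzygies_eq_image[OF U(2)[of 0]] by (simp add: M_def b_def)
    finally show ?thesis .
  qed
  have kernel: "{v \<in> free_module n (b (Suc i)). M i *\<^sub>v v = 0\<^sub>v (b i)} =
      (\<lambda>w. M (Suc i) *\<^sub>v w) ` free_module n (b (Suc (Suc i)))" for i
  proof -
    have "M i *\<^sub>v v = 0\<^sub>v (b i) \<longleftrightarrow> (\<forall>c. comb (U (Suc i)) (fun_of_vec v) c = 0)"
      if v: "v \<in> free_module n (b (Suc i))" for v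
    proof -
      have vc: "v \<in> carrier_vec (length (U (Suc i)))" using v by (simp add: free_module_def b_def)
      have "M i *\<^sub>v v = 0\<^sub>v (b i) \<longleftrightarrow> (\<forall>c<b i. comb (U (Suc i)) (fun_of_vec v) c = 0)"
        using mat_of_gens_mult[OF vc] by (auto simp: vec_eq_iff M_def) (simp_all add: mat_of_gens_def)
      moreover have "comb (U (Suc i)) s c = 0" if "c \<ge> b i" for s c
        unfolding comb_def using support[OF nth_mem that] by (intro sum.neutral) simp
      ultimately show ?thesis by (metis not_le)
    qed
    then have "{v \<in> free_module n (b (Suc i)). M i *\<^sub>v v = 0\<^sub>v (b i)} =
        {v \<in> free_module n (length (U (Suc i))). \<forall>c. comb (U (Suc i)) (fun_of_vec v) c = 0}"
      by (auto simp: b_def)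
    also have "\<dots> = (\<lambda>w. M (Suc i) *\<^sub>v w) ` free_module n (b (Suc (Suc i)))"
      using syzygies_eq_image[OF U(2)[of "Suc i"]] by (simp add: M_def b_def)
    finally show ?thesis .
  qed
  have "graded_free_resolution n ((\<lambda>w. w 0) ` pspan n us) b (\<lambda>i j. q + i) g M"
    unfolding graded_free_resolution_def
  proof (intro conjI allI impI ballI)
    show "g \<in> free_module n (b 0)" using g_entry by (simp add: free_module_def g_def)
    show "M i \<in> carrier_mat (b i) (b (Suc i))" for i
      by (simp add: M_def mat_of_gens_def b_def)
  qed (use g_entry entry_prop image kernel0 kernel in \<open>auto simp: homogeneous_def\<close>)
  moreover have "Poly_Mapping.lookup (M i $$ (r, c)) 0 = 0" if "r < b i" "c < b (Suc i)" for i r c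
    using entry_prop[OF that] homogeneous_constant_term by auto
  ultimately have "minimal_graded_free_resolution n ((\<lambda>w. w 0) ` pspan n us) b (\<lambda>i j. q + i) g M"
    by (simp add: minimal_graded_free_resolution_def)
  then show ?thesis unfolding has_linear_resolution_def by blast
qed

section \<open>Squarefree monomial ideals\<close>

text \<open>For squarefree monomials, the colon ideal of the earlier x_G by x_F is generated by the
  monomials x_(G-F). The condition asks that each of these be divisible by a variable that is itself
  one of them.\<close>

inductive lq_sets :: "nat set list \<Rightarrow> bool" where
  Nil: "lq_sets []"
| snoc: "lq_sets Fs \<Longrightarrow> \<forall>G\<in>set Fs. \<exists>H\<in>set Fs. \<exists>x\<in>G - F. H - F = {x} \<Longrightarrow> lq_sets (Fs @ [F])"

definition mon_ideal :: "nat \<Rightarrow> nat set set \<Rightarrow> 'k::field polynomial set" where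
  "mon_ideal n \<F> = {p \<in> pring n. \<forall>m\<in>Poly_Mapping.keys p. \<exists>F\<in>\<F>. F \<subseteq> Poly_Mapping.keys m}"

definition cvec :: "'k::field polynomial \<Rightarrow> nat \<Rightarrow> 'k polynomial" where
  "cvec p = (\<lambda>c. if c = 0 then p else 0)"

lemma keys_sqf_times:
  assumes "finite F"
  shows "Poly_Mapping.keys (sqf_poly F * p) = (+) (sqf_monomial F) ` Poly_Mapping.keys p"
proof
  show "(+) (sqf_monomial F) ` Poly_Mapping.keys p \<subseteq> Poly_Mapping.keys (sqf_poly F * p)"
    by (auto simp: in_keys_iff sqf_poly_def lookup_single_times)
qed (simp add: sqf_poly_def keys_single_times)

lemma mon_ideal_mono: "\<A> \<subseteq> \<B> \<Longrightarrow> p \<in> mon_ideal n \<A> \<Longrightarrow> p \<in> mon_ideal n \<B>"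
  unfolding mon_ideal_def by blast

lemma mon_ideal_add: "p \<in> mon_ideal n \<A> \<Longrightarrow> r \<in> mon_ideal n \<A> \<Longrightarrow> p + r \<in> mon_ideal n \<A>"
  unfolding mon_ideal_def using keys_add[of p r] pring_add[of p n r] by blast

lemma sqf_times_in_mon_ideal:
  assumes "F \<subseteq> {1..n}" "p \<in> pring n"
  shows "sqf_poly F * p \<in> mon_ideal n \<A> \<longleftrightarrow>
    (\<forall>m\<in>Poly_Mapping.keys p. \<exists>G\<in>\<A>. G \<subseteq> F \<union> Poly_Mapping.keys m)"
proof -
  have F: "finite F" using assms(1) finite_subset by blast
  show ?thesis
    using assms pring_mult[OF pring_sqf[OF F assms(1)] assms(2)]
    by (auto simp: mon_ideal_def keys_sqf_times[OF F] keys_plus_nat keys_sqf_monomial[OF F])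
qed

lemma mon_ideal_insert:
  assumes "F \<subseteq> {1..n}"
  shows "mon_ideal n (insert F \<A>) = {t + sqf_poly F * p | t p. t \<in> mon_ideal n \<A> \<and> p \<in> pring n}" (is "?L = ?R")
proof
  have F: "finite F" using assms finite_subset by blast
  show "?L \<subseteq> ?R"
  proof
    fix f :: "'a polynomial" assume f: "f \<in> ?L"
    then have fp: "f \<in> pring n" by (simp add: mon_ideal_def)
    obtain p t where *: "p \<in> pring n" "f = t + sqf_poly F * p"
      "Poly_Mapping.keys t \<subseteq> {m \<in> Poly_Mapping.keys f. \<not> F \<subseteq> Poly_Mapping.keys m}"
      using sqf_poly_split[OF fp F] by blast
    have "t \<in> mon_ideal n \<A>"
      unfolding mon_ideal_def pring_iff mem_Collect_eq
    proof (intro conjI ballI)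
      fix m assume "m \<in> Poly_Mapping.keys t"
      then have "m \<in> Poly_Mapping.keys f" "\<not> F \<subseteq> Poly_Mapping.keys m" using *(3) by auto
      then show "Poly_Mapping.keys m \<subseteq> {1..n}" "\<exists>G\<in>\<A>. G \<subseteq> Poly_Mapping.keys m"
        using f unfolding mon_ideal_def pring_iff by blast+
    qed
    then show "f \<in> ?R" using * by blast
  qed
  show "?R \<subseteq> ?L"
    using sqf_times_in_mon_ideal[OF assms]
    by (auto intro!: mon_ideal_add intro: mon_ideal_mono[of \<A> "insert F \<A>"])
qed

lemma pspan_sqf:
  assumes "\<forall>F\<in>set Fs. F \<subseteq> {1..n}"
  shows "pspan n (map (\<lambda>F. cvec (sqf_poly F)) Fs) =
    cvec ` (mon_ideal n (set Fs) :: 'k::field polynomial set)"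
  using assms
proof (induction Fs rule: rev_induct)
  case Nil
  have "mon_ideal n {} = {0 :: 'k polynomial}" by (auto simp: mon_ideal_def pring_0)
  then show ?case by (simp add: pspan_Nil cvec_def)
next
  case (snoc F Fs)
  have *: "(\<lambda>c. cvec t c + p * cvec r c) = cvec (t + r * p)" for t p r
    by (auto simp: cvec_def mult.commute)
  have IH: "pspan n (map (\<lambda>F. cvec (sqf_poly F)) Fs) = cvec ` (mon_ideal n (set Fs) :: 'k polynomial set)"
    using snoc by simp
  have "pspan n (map (\<lambda>F. cvec (sqf_poly F)) Fs @ [cvec (sqf_poly F :: 'k polynomial)]) =
    {\<lambda>c. cvec t c + p * cvec (sqf_poly F) c | t p. t \<in> mon_ideal n (set Fs) \<and> p \<in> pring n}"
    unfolding pspan_snoc IH by blast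
  also have "\<dots> = {cvec (t + sqf_poly F * p) | t p. t \<in> mon_ideal n (set Fs) \<and> p \<in> pring n}"
    unfolding * ..
  also have "\<dots> = cvec ` mon_ideal n (insert F (set Fs))"
    using snoc.prems by (subst mon_ideal_insert) auto
  finally show ?case by simp
qed

lemma inj_cvec: "cvec p = cvec r \<longleftrightarrow> p = r"
  by (metis cvec_def)

lemma linear_quotients_sqf:
  assumes "lq_sets Fs" "\<forall>F\<in>set Fs. F \<subseteq> {1..n} \<and> card F = q"
  shows "linear_quotients n q (map (\<lambda>F. cvec (sqf_poly F) :: nat \<Rightarrow> 'k::field polynomial) Fs)"
  using assms
proof (induction rule: lq_sets.induct)
  case (snoc Fs F)
  have F: "F \<subseteq> {1..n}" "finite F" "card F = q" using snoc.prems finite_subset by auto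
  define X where "X = {x. \<exists>H\<in>set Fs. H - F = {x}}"
  have X: "X \<subseteq> {1..n}"
  proof
    fix x assume "x \<in> X"
    then obtain H where "H \<in> set Fs" "H - F = {x}" by (auto simp: X_def)
    then have "x \<in> H" "H \<in> set (Fs @ [F])" by auto
    then show "x \<in> {1..n}" using snoc.prems by blast
  qed
  have colon: "(\<lambda>c. p * cvec (sqf_poly F) c) \<in> pspan n (map (\<lambda>F. cvec (sqf_poly F)) Fs) \<longleftrightarrow>
      p \<in> var_ideal n X" if p: "p \<in> pring n" for p :: "'k polynomial"
  proof -
    have "(\<lambda>c. p * cvec (sqf_poly F) c) = cvec (sqf_poly F * p)"
      by (auto simp: cvec_def mult.commute)
    then have "(\<lambda>c. p * cvec (sqf_poly F) c) \<in> pspan n (map (\<lambda>F. cvec (sqf_poly F)) Fs) \<longleftrightarrow>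
        sqf_poly F * p \<in> mon_ideal n (set Fs)"
      using snoc.prems by (auto simp: pspan_sqf inj_cvec image_iff)
    also have "\<dots> \<longleftrightarrow> p \<in> var_ideal n X"
    proof -
      \<comment> \<open>With K the support of a monomial m, the left side says that x_F m lies in
        the ideal of the earlier sets, the right side that m lies in the ideal of the variables in
        \<open>X\<close>. The condition of \<open>lq_sets\<close> is needed from left to
        right.\<close>
      have "(\<exists>G\<in>set Fs. G \<subseteq> F \<union> K) \<longleftrightarrow> K \<inter> X \<noteq> {}" for K
      proof
        assume "\<exists>G\<in>set Fs. G \<subseteq> F \<union> K"
        then obtain G where G: "G \<in> set Fs" "G \<subseteq> F \<union> K" by blast
        then obtain H x where "H \<in> set Fs" "x \<in> G - F" "H - F = {x}"
          using bspec[OF snoc.hyps(2) G(1)] by blast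
        then show "K \<inter> X \<noteq> {}" using G(2) by (auto simp: X_def)
      next
        assume "K \<inter> X \<noteq> {}"
        then obtain x H where "x \<in> K" "H \<in> set Fs" "H - F = {x}" by (auto simp: X_def)
        then show "\<exists>G\<in>set Fs. G \<subseteq> F \<union> K" by (intro bexI[of _ H]) auto
      qed
      then show ?thesis using p by (simp add: sqf_times_in_mon_ideal[OF F(1) p] var_ideal_def)
    qed
    finally show ?thesis .
  qed
  have "linear_quotients n q (map (\<lambda>F. cvec (sqf_poly F) :: nat \<Rightarrow> 'k polynomial) Fs @ [cvec (sqf_poly F)])"
  proof (rule linear_quotients.snoc[OF _ _ X])
    show "\<forall>c. (cvec (sqf_poly F) :: nat \<Rightarrow> 'k polynomial) c \<in> pring n \<and> homogeneous q (cvec (sqf_poly F :: 'k polynomial) c)"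
      using homogeneous_sqf[OF F(2), where 'a='k] pring_sqf[OF F(2,1), where 'a='k] F(3)
      by (simp add: cvec_def homogeneous_0 pring_0)
  qed (use snoc colon in auto)
  then show ?case by simp
qed (simp add: linear_quotients.Nil)

text \<open>The support description is closed under the ideal operations. Conversely, an ideal
  containing all generators contains \<open>mon_ideal n \<F>\<close> by induction on the finite
  family, splitting off the terms divisible by one generator at a time.\<close>

lemma genideal_mon_ideal:
  assumes "\<forall>F\<in>\<F>. F \<subseteq> {1..n}"
  shows "genideal (poly_ring n) ((\<lambda>F. sqf_poly F) ` \<F>) = (mon_ideal n \<F> :: 'k::field polynomial set)"
proof -
  interpret cring "poly_ring n :: 'k polynomial ring" by (rule cring_poly_ring)
  have fin: "finite \<F>" using assms by (intro finite_subset[of \<F> "Pow {1..n}"]) auto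
  have gens: "sqf_poly ` \<F> \<subseteq> (pring n :: 'k polynomial set)"
    using assms finite_subset[of _ "{1..n}"] by (intro image_subsetI pring_sqf) blast+
  have id: "ideal (mon_ideal n \<F> :: 'k polynomial set) (poly_ring n)"
  proof (rule idealI[OF ring_axioms])
    have zero: "0 \<in> (mon_ideal n \<F> :: 'k polynomial set)"
      and sub: "p \<in> mon_ideal n \<F> \<Longrightarrow> p \<in> pring n" for p :: "'k polynomial"
      by (simp_all add: mon_ideal_def pring_0)
    have "- p \<in> mon_ideal n \<F>" if "p \<in> mon_ideal n \<F>" for p :: "'k polynomial"
      using that by (simp add: mon_ideal_def keys_uminus_poly pring_uminus)
    moreover have "\<ominus>\<^bsub>poly_ring n\<^esub> p = - p" if "p \<in> pring n" for p :: "'k polynomial"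
      using that by (intro minus_equality) (simp_all add: poly_ring_ops pring_uminus)
    ultimately show "subgroup (mon_ideal n \<F> :: 'k polynomial set) (add_monoid (poly_ring n))"
      using zero sub by (intro add.subgroupI) (auto simp: poly_ring_ops mon_ideal_add a_inv_def[symmetric])
    have mult: "r * p \<in> mon_ideal n \<F>" if p: "p \<in> mon_ideal n \<F>" and r: "r \<in> pring n" for p r :: "'k polynomial"
    proof -
      have "\<exists>F\<in>\<F>. F \<subseteq> Poly_Mapping.keys m" if m: "m \<in> Poly_Mapping.keys (r * p)" for m
      proof -
        obtain a b where ab: "m = a + b" "b \<in> Poly_Mapping.keys p"
          using m keys_mult[of r p] by blast
        obtain F where "F \<in> \<F>" "F \<subseteq> Poly_Mapping.keys b"
          using p ab(2) unfolding mon_ideal_def by blast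
        then show ?thesis unfolding ab(1) keys_plus_nat by blast
      qed
      then show ?thesis using p r by (simp add: mon_ideal_def pring_mult)
    qed
    show "x \<otimes>\<^bsub>poly_ring n\<^esub> a \<in> mon_ideal n \<F>" "a \<otimes>\<^bsub>poly_ring n\<^esub> x \<in> mon_ideal n \<F>"
      if "a \<in> mon_ideal n \<F>" "x \<in> carrier (poly_ring n)" for a x :: "'k polynomial"
      using mult[OF that] by (simp_all add: poly_ring_ops mult.commute)
  qed
  have "mon_ideal n \<F> \<subseteq> J" if J: "ideal J (poly_ring n)" "sqf_poly ` \<F> \<subseteq> J" for J :: "'k polynomial set"
    using fin assms J(2)
  proof (induction \<F> rule: finite_induct)
    case empty
    have "\<zero>\<^bsub>poly_ring n\<^esub> \<in> J" using J(1) by (simp add: additive_subgroup.zero_closed ideal.axioms(1))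
    then show ?case by (auto simp: mon_ideal_def poly_ring_ops)
  next
    case (insert F \<F>)
    have "t + sqf_poly F * p \<in> J" if "t \<in> J" "p \<in> pring n" for t p
    proof -
      have "sqf_poly F \<otimes>\<^bsub>poly_ring n\<^esub> p \<in> J"
        using insert.prems that J(1) by (intro ideal.I_r_closed) auto
      then have "t \<oplus>\<^bsub>poly_ring n\<^esub> (sqf_poly F \<otimes>\<^bsub>poly_ring n\<^esub> p) \<in> J"
        using that J(1) by (intro additive_subgroup.a_closed ideal.axioms(1))
      then show ?thesis by (simp add: poly_ring_ops)
    qed
    then show ?case using insert by (subst mon_ideal_insert) auto
  qed
  moreover have "(sqf_poly F :: 'k polynomial) \<in> mon_ideal n \<F>" if "F \<in> \<F>" for F
  proof -
    have F: "F \<subseteq> {1..n}" using assms that by blast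
    then show ?thesis
      using sqf_times_in_mon_ideal[OF F pring_1, of \<F>] that by auto
  qed
  ultimately show ?thesis
    using id genideal_minimal[of "mon_ideal n \<F>" "sqf_poly ` \<F>"] genideal_ideal[OF gens] genideal_self[OF gens]
    by (metis image_subsetI subset_antisym)
qed

section \<open>Vertex decomposable clutters\<close>

text \<open>In the language of simplicial collapses, \<open>e\<close> is a free face of the circuit
  \<open>F\<close>; the property says that all circuits can be collapsed away through free faces of
  codimension one. It implies both chordality and the absence of CF-cycles.\<close>

inductive free_elim :: "nat \<Rightarrow> nat set set \<Rightarrow> bool" for d where
  empty: "free_elim d {}"
| step: "\<lbrakk>card e = d; {G \<in> C. e \<subseteq> G} = {F}; free_elim d (C - {F})\<rbrakk> \<Longrightarrow> free_elim d C"

lemma free_elim_subfamily: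
  "free_elim d C \<Longrightarrow> Z \<subseteq> C \<Longrightarrow> Z \<noteq> {} \<Longrightarrow> \<exists>e F. card e = d \<and> {G \<in> Z. e \<subseteq> G} = {F}"
proof (induction rule: free_elim.induct)
  case (step e C F)
  show ?case
  proof (cases "F \<in> Z")
    case True
    then have "{G \<in> Z. e \<subseteq> G} = {F}" using step.hyps(2) step.prems(1) by blast
    then show ?thesis using step.hyps(1) by blast
  next
    case False
    then show ?thesis using step by blast
  qed
qed simp

lemma free_elim_CF_tree:
  assumes "d_clutter n d C" "C \<noteq> {}" "free_elim d C"
  shows "CF_tree n d C"
  unfolding CF_tree_def
proof (intro conjI assms notI)
  assume "\<exists>Z\<subseteq>C. CF_cycle n d Z"
  then obtain Z where Z: "Z \<subseteq> C" "CF_cycle n d Z" by blast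
  then obtain e F where e: "card e = d" "{G \<in> Z. e \<subseteq> G} = {F}"
    using free_elim_subfamily[OF assms(3)] by (metis CF_cycle_def)
  have "F \<in> {G \<in> Z. e \<subseteq> G}" unfolding e(2) by simp
  then have F: "F \<in> Z" "e \<subseteq> F" by auto
  then have "F \<subseteq> {1..n}" using Z(1) assms(1) by (auto simp: d_clutter_def)
  then have "e \<in> max_subcircuits n d Z" using F e(1) by (auto simp: max_subcircuits_def)
  then have "even (circuit_deg Z e)" using Z(2) by (simp add: CF_cycle_def)
  then show False by (simp add: circuit_deg_def e(2))
qed

text \<open>A subcircuit contained in exactly one circuit is simplicial, its closed neighbourhood
  being contained in that circuit.\<close>

lemma free_elim_chordal: "free_elim d C \<Longrightarrow> d_clutter n d C \<Longrightarrow> chordal n d C"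
proof (induction rule: free_elim.induct)
  case empty
  then show ?case by (simp add: chordal_def)
next
  case (step e C F)
  have "F \<in> {G \<in> C. e \<subseteq> G}" unfolding step.hyps(2) by simp
  then have F: "F \<in> C" "e \<subseteq> F" by auto
  have Fn: "F \<subseteq> {1..n}" "card F = d + 1" using F(1) step.prems by (auto simp: d_clutter_def)
  have fin: "finite F" using Fn(1) finite_subset by blast
  have rem: "remove_subcircuit C e = C - {F}"
    unfolding step.hyps(2)[symmetric] by (auto simp: remove_subcircuit_def)
  have "chordal n d (C - {F})" using step by (auto simp: d_clutter_def)
  \<comment> \<open>If no circuit other than \<open>F\<close> exists, the empty sequence
    serves.\<close>
  then obtain es where es:
    "\<forall>i<length es. simplicial_subcircuit n d (foldl remove_subcircuit (C - {F}) (take i es)) (es ! i)"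
    "foldl remove_subcircuit (C - {F}) es = {}"
    unfolding chordal_def by (metis foldl_Nil less_nat_zero_code list.size(3))
  have "e \<union> {v} = F" if "e \<union> {v} \<in> C" for v
  proof -
    have "e \<union> {v} \<in> {G \<in> C. e \<subseteq> G}" using that by (simp add: subset_insertI)
    then show ?thesis unfolding step.hyps(2) by simp
  qed
  then have nbhd: "closed_nbhd n C e \<subseteq> F" using F(2) by (auto simp: closed_nbhd_def)
  have "simplicial_subcircuit n d C e"
    unfolding simplicial_subcircuit_def clutter_clique_def
  proof (intro conjI allI impI)
    show "e \<in> max_subcircuits n d C" using F Fn step.hyps(1) by (auto simp: max_subcircuits_def)
    show "closed_nbhd n C e \<subseteq> {1..n}" using nbhd Fn by blast
    fix G assume "G \<subseteq> closed_nbhd n C e \<and> card G = d + 1"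
    then have "G = F" using nbhd Fn(2) fin by (metis card_subset_eq subset_trans)
    then show "G \<in> C" using F by simp
  qed
  then have "\<forall>i<length (e # es). simplicial_subcircuit n d
      (foldl remove_subcircuit C (take i (e # es))) ((e # es) ! i)"
    using es(1) by (auto simp: rem less_Suc_eq_0_disj)
  moreover have "foldl remove_subcircuit C (e # es) = {}" using es(2) by (simp add: rem)
  ultimately show ?case unfolding chordal_def by blast
qed

text \<open>Circuits of \<open>D\<close> avoid v, so they cannot contain v + e. A subcircuit that is
  free in the link thus stays free after v is added, whatever \<open>D\<close> is.\<close>

lemma free_elim_join:
  assumes "free_elim d L" "free_elim (Suc d) D"
    and "\<forall>F\<in>L. finite F \<and> v \<notin> F" "\<forall>F\<in>D. v \<notin> F"
  shows "free_elim (Suc d) (insert v ` L \<union> D)"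
  using assms(1,3)
proof (induction rule: free_elim.induct)
  case empty
  then show ?case using assms(2) by simp
next
  case (step e L F)
  have "F \<in> {G \<in> L. e \<subseteq> G}" unfolding step.hyps(2) by simp
  then have F: "F \<in> L" "e \<subseteq> F" by auto
  have e: "finite e" "v \<notin> e" using F step.prems finite_subset by blast+
  have sub: "insert v e \<subseteq> insert v G \<longleftrightarrow> e \<subseteq> G" if "v \<notin> G" for G
    using e(2) by blast
  show ?case
  proof (rule free_elim.step)
    show "card (insert v e) = Suc d" using e step.hyps(1) by simp
    show "{G \<in> insert v ` L \<union> D. insert v e \<subseteq> G} = {insert v F}"
    proof (intro equalityI subsetI)
      fix G assume G: "G \<in> {G \<in> insert v ` L \<union> D. insert v e \<subseteq> G}"
      then have "G \<notin> D" using assms(4) by blast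
      then obtain K where K: "G = insert v K" "K \<in> L" using G by blast
      have "v \<notin> K" using K(2) step.prems by blast
      moreover have "insert v e \<subseteq> insert v K" using G K(1) by simp
      ultimately have "K \<in> {G \<in> L. e \<subseteq> G}" using K(2) sub by simp
      then have "K = F" unfolding step.hyps(2) by simp
      then show "G \<in> {insert v F}" using K by simp
    qed (use F in auto)
    have "inj_on (insert v) L" using step.prems by (intro inj_onI) (metis insert_ident)
    then have "insert v ` (L - {F}) = insert v ` L - {insert v F}"
      using inj_on_image_set_diff[of "insert v" L L "{F}"] F(1) by auto
    moreover have "insert v F \<notin> D" using assms(4) by blast
    ultimately have "insert v ` L \<union> D - {insert v F} = insert v ` (L - {F}) \<union> D"
      by (simp add: Un_Diff)
    then show "free_elim (Suc d) (insert v ` L \<union> D - {insert v F})" using step by simp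
  qed
qed

text \<open>Otherwise all (d+1)-subsets of \<open>G\<close> would form a subfamily of
  \<open>C\<close>, but none of its subcircuits is free. The lemma serves twice: it compares the
  non-circuits of link and deletion, and it bounds the size of minimal non-faces.\<close>

lemma free_elim_no_simplex_boundary:
  assumes "free_elim d C" "card G = Suc (Suc d)"
  shows "\<exists>H\<subseteq>G. card H = Suc d \<and> H \<notin> C"
proof (rule ccontr)
  assume *: "\<not> ?thesis"
  define Z where "Z = {H. H \<subseteq> G \<and> card H = Suc d}"
  have fin: "finite G" using assms(2) card.infinite by fastforce
  have "Z \<subseteq> C" using * by (auto simp: Z_def)
  moreover have "Z \<noteq> {}"
    using obtain_subset_with_card_n[of "Suc d" G] assms(2) unfolding Z_def by fastforce
  ultimately obtain e F where e: "card e = d" "{H \<in> Z. e \<subseteq> H} = {F}"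
    using free_elim_subfamily[OF assms(1)] by blast
  have "F \<in> {H \<in> Z. e \<subseteq> H}" unfolding e(2) by simp
  then have F: "F \<subseteq> G" "card F = Suc d" "e \<subseteq> F" by (auto simp: Z_def)
  have "F \<noteq> G" using F(2) assms(2) by auto
  then obtain y where y: "y \<in> G" "y \<notin> F" using F(1) by blast
  have "finite e" using F fin by (meson finite_subset)
  moreover have "y \<notin> e" using y F by blast
  \<comment> \<open>With \<open>y\<close> the vertex of \<open>G\<close> opposite to
    \<open>F\<close>, the set y + e is a second face containing \<open>e\<close>.\<close>
  ultimately have "insert y e \<in> Z" using e(1) y F by (auto simp: Z_def)
  then have "insert y e \<in> {H \<in> Z. e \<subseteq> H}" by auto
  then have "insert y e = F" unfolding e(2) by simp
  then show False using y(2) by blast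
qed

section \<open>Linear quotients for the non-circuits\<close>

definition non_circuits :: "nat set \<Rightarrow> nat \<Rightarrow> nat set set \<Rightarrow> nat set set" where
  "non_circuits V q C = {F. F \<subseteq> V \<and> card F = q \<and> F \<notin> C}"

definition has_lq :: "nat set set \<Rightarrow> bool" where
  "has_lq \<F> \<longleftrightarrow> (\<exists>Fs. set Fs = \<F> \<and> lq_sets Fs)"

text \<open>The sets containing v are listed before the others. When \<open>F\<close> from
  \<open>B\<close> is added, an \<open>H\<close> in \<open>A\<close> below it gives an earlier set v
  + H whose difference with \<open>F\<close> is exactly {v}, and v belongs to every earlier set
  coming from \<open>A\<close>. Among sets of the same block the differences are unaffected by
  v.\<close>

lemma has_lq_split:
  assumes "has_lq A" "has_lq B" "\<forall>F\<in>A \<union> B. v \<notin> F" "\<forall>F\<in>B. \<exists>H\<in>A. H \<subseteq> F"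
  shows "has_lq (insert v ` A \<union> B)"
proof -
  obtain As Bs where As: "set As = A" "lq_sets As" and Bs: "set Bs = B" "lq_sets Bs"
    using assms(1,2) by (auto simp: has_lq_def)
  have "\<forall>F\<in>set As. v \<notin> F" using assms(3) As(1) by blast
  with As(2) have ins: "lq_sets (map (insert v) As)"
  proof (induction rule: lq_sets.induct)
    case (snoc Fs F)
    have "insert v G - insert v F = G - F" if "G \<in> set Fs" for G
      using snoc.prems that by auto
    then have "lq_sets (map (insert v) Fs @ [insert v F])"
      using snoc by (intro lq_sets.snoc) auto
    then show ?case by simp
  qed (simp add: lq_sets.Nil)
  have "\<forall>F\<in>set Bs. v \<notin> F \<and> (\<exists>H\<in>A. H \<subseteq> F)" using assms(3,4) Bs(1) by blast
  with Bs(2) have "lq_sets (map (insert v) As @ Bs)"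
  proof (induction rule: lq_sets.induct)
    case (snoc Fs F)
    obtain H where H: "H \<in> A" "H \<subseteq> F" using snoc.prems by auto
    have v: "v \<notin> F" using snoc.prems by auto
    have "lq_sets ((map (insert v) As @ Fs) @ [F])"
    proof (rule lq_sets.snoc)
      show "\<forall>G\<in>set (map (insert v) As @ Fs). \<exists>H\<in>set (map (insert v) As @ Fs). \<exists>x\<in>G - F. H - F = {x}"
      proof
        fix G assume "G \<in> set (map (insert v) As @ Fs)"
        then consider "G \<in> insert v ` A" | "G \<in> set Fs" using As(1) by auto
        then show "\<exists>H\<in>set (map (insert v) As @ Fs). \<exists>x\<in>G - F. H - F = {x}"
        proof cases
          case 1
          then have "insert v H - F = {v}" "v \<in> G - F" using H(2) v by auto
          then show ?thesis using H(1) As(1) by (intro bexI[of _ "insert v H"] bexI[of _ v]) auto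
        next
          case 2
          then show ?thesis using bspec[OF snoc.hyps(2) 2] by auto
        qed
      qed
    qed (use snoc in auto)
    then show ?case by simp
  qed (simp add: ins)
  then show ?thesis
    unfolding has_lq_def using As(1) Bs(1) by (intro exI[of _ "map (insert v) As @ Bs"]) simp
qed

lemma non_circuits_split:
  assumes "finite V" "v \<in> V" "\<forall>F\<in>L \<union> D. v \<notin> F"
  shows "non_circuits V (Suc q) (insert v ` L \<union> D) =
    insert v ` non_circuits (V - {v}) q L \<union> non_circuits (V - {v}) (Suc q) D" (is "?N = ?R")
proof (intro equalityI subsetI)
  fix F assume F: "F \<in> ?N"
  then have fin: "finite F" using assms(1) by (auto simp: non_circuits_def intro: finite_subset)
  show "F \<in> ?R"
  proof (cases "v \<in> F")
    case True
    then have ins: "F = insert v (F - {v})" by blast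
    then have "F - {v} \<notin> L" using F unfolding non_circuits_def by blast
    then have "F - {v} \<in> non_circuits (V - {v}) q L"
      using F True fin by (auto simp: non_circuits_def)
    then show ?thesis using ins by blast
  next
    case False
    then show ?thesis using F by (auto simp: non_circuits_def)
  qed
next
  fix F assume "F \<in> ?R"
  then show "F \<in> ?N"
  proof
    assume "F \<in> insert v ` non_circuits (V - {v}) q L"
    then obtain K where K: "F = insert v K" "K \<subseteq> V - {v}" "card K = q" "K \<notin> L"
      by (auto simp: non_circuits_def)
    have fin: "finite K" using K(2) assms(1) by (meson finite_Diff finite_subset)
    have "v \<notin> K" using K(2) by blast
    then have "card F = Suc q" using fin K by simp
    moreover have "F \<notin> insert v ` L"
    proof
      assume "F \<in> insert v ` L"
      then obtain G where G: "G \<in> L" "insert v G = insert v K" using K(1) by auto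
      then have "v \<notin> G" using assms(3) by blast
      then have "G = K" using G(2) \<open>v \<notin> K\<close> by (metis insert_ident)
      then show False using G(1) K(4) by blast
    qed
    moreover have "F \<notin> D" using K(1) assms(3) by blast
    moreover have "F \<subseteq> V" using K(1,2) assms(2) by blast
    ultimately show ?thesis by (simp add: non_circuits_def)
  next
    assume "F \<in> non_circuits (V - {v}) (Suc q) D"
    then show ?thesis by (auto simp: non_circuits_def)
  qed
qed

text \<open>Splitting at any point of \<open>V\<close> works here, as a nonempty set always contains
  one with an element less. The lemma covers families without circuits: an empty deletion, and the
  empty link of a point outside the only circuit.\<close>

lemma has_lq_all_subsets: "finite V \<Longrightarrow> has_lq (non_circuits V q {})"
proof (induction V arbitrary: q rule: finite_induct)
  case empty
  have 1: "lq_sets [{}]" using lq_sets.snoc[OF lq_sets.Nil] by simp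
  have "non_circuits {} q {} = (if q = 0 then {{}} else {})" by (auto simp: non_circuits_def)
  then show ?case
    using 1 lq_sets.Nil by (auto simp: has_lq_def intro: exI[of _ "[{}]"])
next
  case (insert v V)
  show ?case
  proof (cases q)
    case 0
    have 1: "lq_sets [{}]" using lq_sets.snoc[OF lq_sets.Nil] by simp
    have "non_circuits (insert v V) q {} = {{}}"
      using 0 insert.hyps(1) finite_subset[of _ "insert v V"] by (auto simp: non_circuits_def)
    then show ?thesis using 1 unfolding has_lq_def by (intro exI[of _ "[{}]"]) simp
  next
    case (Suc p)
    have "non_circuits (insert v V) (Suc p) {} =
        insert v ` non_circuits V p {} \<union> non_circuits V (Suc p) {}"
      using non_circuits_split[of "insert v V" v "{}" "{}" p] insert.hyps by simp
    moreover have "has_lq \<dots>"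
    proof (rule has_lq_split[OF insert.IH insert.IH])
      show "\<forall>F\<in>non_circuits V p {} \<union> non_circuits V (Suc p) {}. v \<notin> F"
        using insert.hyps(2) by (auto simp: non_circuits_def)
      show "\<forall>F\<in>non_circuits V (Suc p) {}. \<exists>H\<in>non_circuits V p {}. H \<subseteq> F"
      proof
        fix F assume F: "F \<in> non_circuits V (Suc p) {}"
        then obtain H where "H \<subseteq> F" "card H = p"
          using obtain_subset_with_card_n[of p F] by (auto simp: non_circuits_def)
        then show "\<exists>H\<in>non_circuits V p {}. H \<subseteq> F" using F by (auto simp: non_circuits_def)
      qed
    qed
    ultimately show ?thesis using Suc by simp
  qed
qed

text \<open>This is the simplex case of the decomposition. The ground set may exceed the simplex,
  and its extra points are split off one by one: each has a link without circuits and a deletion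
  with the single circuit \<open>F\<close>. Once only \<open>F\<close> remains, there is no
  non-circuit left.\<close>

lemma has_lq_all_but_one:
  assumes "finite W" "finite F" "W \<inter> F = {}"
  shows "has_lq (non_circuits (F \<union> W) (card F) {F})"
  using assms(1,3)
proof (induction W rule: finite_induct)
  case empty
  have "non_circuits F (card F) {F} = {}"
    using card_subset_eq[OF assms(2)] by (auto simp: non_circuits_def)
  then show ?case using lq_sets.Nil by (auto simp: has_lq_def)
next
  case (insert w W)
  show ?case
  proof (cases "card F")
    case 0
    then have "F = {}" using assms(2) by simp
    then have "non_circuits (F \<union> insert w W) (card F) {F} = {}"
      using insert.hyps(1) finite_subset[of _ "insert w W"] by (auto simp: non_circuits_def)
    then show ?thesis using lq_sets.Nil by (auto simp: has_lq_def)
  next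
    case (Suc p)
    have w: "w \<notin> F \<union> W" using insert by blast
    have fin: "finite (F \<union> W)" using assms(2) insert.hyps by simp
    have "non_circuits (F \<union> insert w W) (Suc p) {F} =
        insert w ` non_circuits (F \<union> W) p {} \<union> non_circuits (F \<union> W) (Suc p) {F}"
      using non_circuits_split[of "insert w (F \<union> W)" w "{}" "{F}" p] w fin by simp
    moreover have "has_lq \<dots>"
    proof (rule has_lq_split[OF has_lq_all_subsets[OF fin]])
      show "has_lq (non_circuits (F \<union> W) (Suc p) {F})" using insert Suc by simp
      show "\<forall>F\<in>non_circuits (F \<union> W) p {} \<union> non_circuits (F \<union> W) (Suc p) {F}. w \<notin> F"
        using w by (auto simp: non_circuits_def)
      show "\<forall>G\<in>non_circuits (F \<union> W) (Suc p) {F}. \<exists>H\<in>non_circuits (F \<union> W) p {}. H \<subseteq> G"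
      proof
        fix G assume G: "G \<in> non_circuits (F \<union> W) (Suc p) {F}"
        then obtain H where H: "H \<subseteq> G" "card H = p"
          using obtain_subset_with_card_n[of p G] by (auto simp: non_circuits_def)
        have "H \<subseteq> F \<union> W" using H(1) G by (auto simp: non_circuits_def)
        then show "\<exists>H\<in>non_circuits (F \<union> W) p {}. H \<subseteq> G"
          using H by (auto simp: non_circuits_def)
      qed
    qed
    ultimately show ?thesis using Suc by simp
  qed
qed

section \<open>Facets and deletions of pure complexes\<close>

lemma facets_complex_of:
  assumes "\<forall>F\<in>C. finite F \<and> card F = q"
  shows "facets (complex_of C) = C"
proof
  show "facets (complex_of C) \<subseteq> C"
    by (auto simp: facets_def complex_of_def)
  show "C \<subseteq> facets (complex_of C)"
  proof
    fix F assume F: "F \<in> C"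
    have "F = G" if G: "G \<in> complex_of C" "F \<subseteq> G" for G
    proof -
      obtain K where K: "K \<in> C" "G \<subseteq> K" using G by (auto simp: complex_of_def)
      then have "F = K" using F G(2) assms by (metis card_subset_eq subset_trans)
      then show ?thesis using K(2) G(2) by blast
    qed
    then show "F \<in> facets (complex_of C)" using F by (auto simp: facets_def complex_of_def)
  qed
qed

lemma face_in_facet:
  assumes "G \<in> \<Delta>" "\<forall>G\<in>\<Delta>. finite G \<and> card G \<le> b"
  obtains K where "K \<in> facets \<Delta>" "G \<subseteq> K"
proof -
  \<comment> \<open>A face above \<open>G\<close> of greatest cardinality is a facet;
    \<open>Suc b\<close> turns the bound into the strict one that the existence of a maximum
    requires.\<close>
  obtain K where K: "K \<in> \<Delta> \<and> G \<subseteq> K" "\<forall>y. y \<in> \<Delta> \<and> G \<subseteq> y \<longrightarrow> card y \<le> card K"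
    using ex_has_greatest_nat[of "\<lambda>K. K \<in> \<Delta> \<and> G \<subseteq> K" G card "Suc b"] assms
    by (auto simp: less_Suc_eq_le)
  have "K = H" if "H \<in> \<Delta>" "K \<subseteq> H" for H
    using K that assms(2) by (metis card_seteq subset_trans)
  then have "K \<in> facets \<Delta>" unfolding facets_def using K(1) by blast
  then show ?thesis using that K(1) by blast
qed

lemma vertex_decomposable_vertices: "vertex_decomposable n \<Delta> \<Longrightarrow> vertices \<Delta> \<noteq> {}"
  by (erule vertex_decomposable.cases) auto

text \<open>A circuit avoiding v is a facet of the deletion of full cardinality \<open>q\<close>. By
  purity all facets of the deletion have this cardinality and are therefore circuits themselves,
  which is the shedding property of v.\<close>

lemma deletion_complex_of:
  assumes unif: "\<forall>F\<in>C. finite F \<and> card F = q"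
    and pure: "pure_complex (deletion (complex_of C) v)" and D: "{F \<in> C. v \<notin> F} \<noteq> {}"
  shows "deletion (complex_of C) v = complex_of {F \<in> C. v \<notin> F}"
proof
  let ?\<Delta> = "complex_of C"
  have bound: "\<forall>G\<in>deletion ?\<Delta> v. finite G \<and> card G \<le> q"
  proof
    fix G assume "G \<in> deletion ?\<Delta> v"
    then obtain F where "F \<in> C" "G \<subseteq> F" by (auto simp: deletion_def complex_of_def)
    then show "finite G \<and> card G \<le> q" using unif card_mono finite_subset by metis
  qed
  obtain F where F: "F \<in> C" "v \<notin> F" using D by blast
  have "F \<in> facets ?\<Delta>" using facets_complex_of[OF unif] F(1) by simp
  then have F': "F \<in> facets (deletion ?\<Delta> v)" using F(2) by (auto simp: facets_def deletion_def)
  show "deletion ?\<Delta> v \<subseteq> complex_of {F \<in> C. v \<notin> F}"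
  proof
    fix G assume "G \<in> deletion ?\<Delta> v"
    then obtain K where K: "K \<in> facets (deletion ?\<Delta> v)" "G \<subseteq> K"
      using face_in_facet bound by metis
    have "card K = card F" using pure K(1) F' unfolding pure_complex_def by blast
    have "v \<notin> K" "K \<in> ?\<Delta>" using K(1) by (simp_all add: facets_def deletion_def)
    then obtain H where H: "H \<in> C" "K \<subseteq> H" unfolding complex_of_def by blast
    have "K = H"
      using card_subset_eq[OF _ H(2)] \<open>card K = card F\<close> unif H(1) F(1) by simp
    then have "K \<in> C" using H(1) by simp
    then show "G \<in> complex_of {F \<in> C. v \<notin> F}"
      using K(2) \<open>v \<notin> K\<close> by (auto simp: complex_of_def)
  qed
  show "complex_of {F \<in> C. v \<notin> F} \<subseteq> deletion ?\<Delta> v"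
    by (auto simp: deletion_def complex_of_def)
qed

text \<open>Both conclusions go through one induction because the splitting of the non-circuits uses
  the elimination of the link. The dimension varies, as the link lowers it by one; the ground set
  varies, as v is taken out of it and it may contain points that are not vertices.\<close>

theorem vertex_decomposable_elim_lq:
  assumes "vertex_decomposable n \<Delta>" "\<Delta> = complex_of C" "\<forall>F\<in>C. finite F \<and> card F = Suc d"
  shows "free_elim d C \<and> (\<forall>V. finite V \<longrightarrow> \<Union>C \<subseteq> V \<longrightarrow> has_lq (non_circuits V (Suc d) C))"
  using assms
proof (induction arbitrary: C d rule: vertex_decomposable.induct)
  case (simplex \<Delta>)
  then obtain F where C: "C = {F}" using facets_complex_of[OF simplex.prems(2)] by auto
  have F: "finite F" "card F = Suc d" using simplex.prems C by auto
  obtain e where e: "e \<subseteq> F" "card e = d" using obtain_subset_with_card_n[of d F] F by auto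
  have "free_elim d C"
    unfolding C
  proof (rule free_elim.step[OF e(2)])
    show "{G \<in> {F}. e \<subseteq> G} = {F}" using e(1) by auto
  qed (simp add: free_elim.empty)
  moreover have "has_lq (non_circuits V (Suc d) C)" if "finite V" "\<Union>C \<subseteq> V" for V
  proof -
    have V: "F \<union> (V - F) = V" using that(2) C by auto
    have "has_lq (non_circuits (F \<union> (V - F)) (card F) {F})"
      by (rule has_lq_all_but_one) (use that(1) F(1) in auto)
    then show ?thesis unfolding V F(2) C .
  qed
  ultimately show ?case by blast
next
  case (decompose \<Delta> v)
  define L where "L = {F - {v} | F. F \<in> C \<and> v \<in> F}"
  define D where "D = {F \<in> C. v \<notin> F}"
  have C: "C = insert v ` L \<union> D"
  proof (intro equalityI subsetI)
    fix F assume F: "F \<in> C"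
    show "F \<in> insert v ` L \<union> D"
    proof (cases "v \<in> F")
      case True
      then have "F - {v} \<in> L" "F = insert v (F - {v})" using F unfolding L_def by blast+
      then show ?thesis by blast
    qed (use F D_def in blast)
  next
    fix F assume "F \<in> insert v ` L \<union> D"
    then show "F \<in> C" by (auto simp: L_def D_def insert_absorb)
  qed
  have vL: "\<forall>F\<in>L. finite F \<and> v \<notin> F \<and> card F = d"
    using decompose.prems(2) by (auto simp: L_def)
  have link: "link \<Delta> v = complex_of L"
  proof (intro equalityI subsetI)
    fix G assume "G \<in> link \<Delta> v"
    then obtain K where K: "G = K - {v}" "v \<in> K" "K \<in> \<Delta>" by (auto simp: link_def)
    then obtain F where F: "F \<in> C" "K \<subseteq> F" by (auto simp: decompose.prems(1) complex_of_def)
    then have "F - {v} \<in> L" "G \<subseteq> F - {v}" using K by (auto simp: L_def)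
    then show "G \<in> complex_of L" by (auto simp: complex_of_def)
  next
    fix G assume "G \<in> complex_of L"
    then obtain F where F: "F \<in> C" "v \<in> F" "G \<subseteq> F - {v}" by (auto simp: complex_of_def L_def)
    then have "insert v G \<in> \<Delta>" "G = insert v G - {v}"
      by (auto simp: decompose.prems(1) complex_of_def)
    then show "G \<in> link \<Delta> v" unfolding link_def by blast
  qed
  \<comment> \<open>The complex with only the empty face is not vertex decomposable, so the link has
    a vertex and its circuits are nonempty; hence d is positive.\<close>
  obtain x where "{x} \<in> complex_of L"
    using vertex_decomposable_vertices[OF decompose.hyps(5)] by (auto simp: vertices_def link)
  then obtain F where "F \<in> L" "x \<in> F" by (auto simp: complex_of_def)
  then have "d \<noteq> 0" using vL by (metis card_gt_0_iff empty_iff less_not_refl)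
  then obtain p where d: "d = Suc p" using not0_implies_Suc by blast
  have IHL: "free_elim p L" "\<And>V. finite V \<Longrightarrow> \<Union>L \<subseteq> V \<Longrightarrow> has_lq (non_circuits V d L)"
    using decompose.IH(1)[OF link, of p] vL d by auto
  have IHD: "free_elim d D \<and> (\<forall>V. finite V \<longrightarrow> \<Union>D \<subseteq> V \<longrightarrow> has_lq (non_circuits V (Suc d) D))"
  \<comment> \<open>If every circuit contains v, the deletion has smaller dimension and is not
    generated by \<open>D\<close>, so its induction hypothesis says nothing about \<open>D\<close>.
    All (d+1)-sets avoiding v are then non-circuits.\<close>
  proof (cases "D = {}")
    case True
    then show ?thesis using has_lq_all_subsets free_elim.empty by simp
  next
    case False
    then have "deletion \<Delta> v = complex_of D"
      using deletion_complex_of[OF decompose.prems(2)] decompose.hyps(6) decompose.prems(1)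
      by (simp add: D_def)
    then show ?thesis using decompose.IH(2) decompose.prems(2) by (simp add: D_def)
  qed
  have "free_elim d C"
    unfolding C d by (rule free_elim_join) (use IHL IHD vL d in \<open>auto simp: D_def\<close>)
  moreover have "has_lq (non_circuits V (Suc d) C)" if V: "finite V" "\<Union>C \<subseteq> V" for V
  proof -
    have "v \<in> V" using decompose.hyps(3) V(2) decompose.prems(1)
      by (auto simp: vertices_def complex_of_def)
    have LD: "\<Union>L \<subseteq> V - {v}" "\<Union>D \<subseteq> V - {v}" "\<forall>F\<in>L \<union> D. v \<notin> F"
    proof -
      show "\<Union>L \<subseteq> V - {v}" using V(2) by (fastforce simp: L_def)
      show "\<Union>D \<subseteq> V - {v}" using V(2) by (auto simp: D_def)
      show "\<forall>F\<in>L \<union> D. v \<notin> F" by (auto simp: L_def D_def)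
    qed
    have "non_circuits V (Suc d) C =
        insert v ` non_circuits (V - {v}) d L \<union> non_circuits (V - {v}) (Suc d) D"
      unfolding C using non_circuits_split[OF V(1) \<open>v \<in> V\<close> LD(3)] .
    moreover have "has_lq \<dots>"
    proof (rule has_lq_split)
      show "has_lq (non_circuits (V - {v}) d L)" using IHL(2) V(1) LD(1) by simp
      show "has_lq (non_circuits (V - {v}) (Suc d) D)" using IHD V(1) LD(2) by simp
      show "\<forall>F\<in>non_circuits (V - {v}) d L \<union> non_circuits (V - {v}) (Suc d) D. v \<notin> F"
        by (auto simp: non_circuits_def)
      show "\<forall>F\<in>non_circuits (V - {v}) (Suc d) D. \<exists>H\<in>non_circuits (V - {v}) d L. H \<subseteq> F"
      proof
        fix F assume F: "F \<in> non_circuits (V - {v}) (Suc d) D"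
        \<comment> \<open>\<open>F\<close> has one element more than the circuits of a simplex
          boundary in dimension d-1, so not all its d-subsets can be circuits of
          \<open>L\<close>.\<close>
        then obtain H where "H \<subseteq> F" "card H = d" "H \<notin> L"
          using free_elim_no_simplex_boundary[OF IHL(1), of F] d by (auto simp: non_circuits_def)
        then show "\<exists>H\<in>non_circuits (V - {v}) d L. H \<subseteq> F" using F by (auto simp: non_circuits_def)
      qed
    qed
    ultimately show ?thesis by simp
  qed
  ultimately show ?case by blast
qed

section \<open>From the completed complex to its Stanley-Reisner ideal\<close>

lemma pure_complex_eq_complex_of:
  assumes "simplicial_complex n \<Delta>" "pure_complex \<Delta>" "complex_dim \<Delta> = int d"
  shows "\<Delta> = complex_of (facets \<Delta>)" "\<forall>F\<in>facets \<Delta>. finite F \<and> card F = Suc d"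
proof -
  have sub: "\<Delta> \<subseteq> Pow {1..n}" and down: "\<And>G H. G \<in> \<Delta> \<Longrightarrow> H \<subseteq> G \<Longrightarrow> H \<in> \<Delta>"
    using assms(1) unfolding simplicial_complex_def by blast+
  then have fin: "finite \<Delta>" by (rule_tac finite_subset[of _ "Pow {1..n}"]) auto
  have finG: "finite G" if "G \<in> \<Delta>" for G
    using that sub finite_subset[of G "{1..n}"] by auto
  have ne: "\<Delta> \<noteq> {}" using assms(1) by (auto simp: simplicial_complex_def)
  have Max: "Max (card ` \<Delta>) = Suc d" using assms(3) by (simp add: complex_dim_def)
  have bound: "\<forall>G\<in>\<Delta>. finite G \<and> card G \<le> Suc d"
  proof
    fix G assume G: "G \<in> \<Delta>"
    then have "card G \<le> Max (card ` \<Delta>)" using fin by (intro Max_ge) auto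
    then show "finite G \<and> card G \<le> Suc d" using finG[OF G] Max by simp
  qed
  show "\<Delta> = complex_of (facets \<Delta>)"
  proof (intro equalityI subsetI)
    fix G assume "G \<in> \<Delta>"
    then obtain K where "K \<in> facets \<Delta>" "G \<subseteq> K" using face_in_facet bound by metis
    then show "G \<in> complex_of (facets \<Delta>)" by (auto simp: complex_of_def)
  next
    fix G assume "G \<in> complex_of (facets \<Delta>)"
    then obtain K where "K \<in> \<Delta>" "G \<subseteq> K" by (auto simp: complex_of_def facets_def)
    then show "G \<in> \<Delta>" using down by blast
  qed
  have "Max (card ` \<Delta>) \<in> card ` \<Delta>" using fin ne by (intro Max_in) auto
  then obtain F where F: "F \<in> \<Delta>" "card F = Suc d" using Max by auto
  obtain K where K: "K \<in> facets \<Delta>" "F \<subseteq> K" using face_in_facet[OF F(1) bound] by blast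
  then have K\<Delta>: "K \<in> \<Delta>" by (simp add: facets_def)
  then have "card K = Suc d"
    using bound K(2) F(2) card_mono[of K F] by (metis le_antisym)
  show "\<forall>F\<in>facets \<Delta>. finite F \<and> card F = Suc d"
  proof
    fix G assume G: "G \<in> facets \<Delta>"
    then have "card G = card K" using assms(2) K(1) unfolding pure_complex_def by blast
    moreover have "finite G" using G finG by (simp add: facets_def)
    ultimately show "finite G \<and> card G = Suc d" using \<open>card K = Suc d\<close> by simp
  qed
qed

lemma min_nonfaces_add_small_faces:
  assumes unif: "\<forall>F\<in>C. finite F \<and> card F = Suc d" and elim: "free_elim d C"
  shows "min_nonfaces n (add_small_faces n d (complex_of C)) = non_circuits {1..n} (Suc d) C"
    (is "?M = ?N")
proof (intro equalityI subsetI)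
  let ?\<Delta> = "add_small_faces n d (complex_of C)"
  have top: "F \<in> C" if F: "F \<in> ?\<Delta>" "card F = Suc d" for F
  proof -
    obtain K where K: "K \<in> C" "F \<subseteq> K" using F by (auto simp: add_small_faces_def complex_of_def)
    have "F = K" using card_subset_eq[OF _ K(2)] unif K(1) F(2) by simp
    then show ?thesis using K(1) by simp
  qed
  {
    fix F assume F: "F \<in> ?M"
    have Fn: "F \<subseteq> {1..n}" "F \<notin> ?\<Delta>" and sub: "\<And>G. G \<subset> F \<Longrightarrow> G \<in> ?\<Delta>"
      using F by (auto simp: min_nonfaces_def)
    have "\<not> card F \<le> d" using Fn by (simp add: add_small_faces_def)
    \<comment> \<open>A larger \<open>F\<close> would contain a (d+1)-set that is not a circuit,
      hence a smaller non-face; it is a proper subset even when \<open>F\<close> has exactly d+2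
      elements.\<close>
    moreover have "card F < Suc (Suc d)"
    proof (rule ccontr)
      assume "\<not> ?thesis"
      then obtain G where G: "G \<subseteq> F" "card G = Suc (Suc d)"
        using obtain_subset_with_card_n[of "Suc (Suc d)" F] by auto
      obtain H where H: "H \<subseteq> G" "card H = Suc d" "H \<notin> C"
        using free_elim_no_simplex_boundary[OF elim G(2)] by blast
      have "H \<noteq> G" using H(2) G(2) by auto
      then have "H \<subset> F" using H(1) G(1) by blast
      then show False using sub top H by blast
    qed
    ultimately have "card F = Suc d" by simp
    moreover have "F \<notin> C" using Fn(2) by (auto simp: add_small_faces_def complex_of_def)
    ultimately show "F \<in> ?N" using Fn(1) by (simp add: non_circuits_def)
  next
    fix F assume "F \<in> ?N"
    then have F: "F \<subseteq> {1..n}" "card F = Suc d" "F \<notin> C" by (simp_all add: non_circuits_def)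
    have "G \<in> ?\<Delta>" if G: "G \<subset> F" for G
    proof -
      have "finite F" using F(1) finite_subset by blast
      then have "card G \<le> d" using psubset_card_mono[OF _ G] F(2) by simp
      then show ?thesis using G F(1) by (auto simp: add_small_faces_def)
    qed
    then show "F \<in> ?M" using F top unfolding min_nonfaces_def by blast
  }
qed

lemma has_lq_imp_linear_resolution:
  assumes "has_lq \<F>" "\<forall>F\<in>\<F>. F \<subseteq> {1..n} \<and> card F = q"
  shows "has_linear_resolution n (mon_ideal n \<F> :: 'k::field polynomial set)"
proof -
  obtain Fs where Fs: "set Fs = \<F>" "lq_sets Fs" using assms(1) by (auto simp: has_lq_def)
  define us where "us = map (\<lambda>F. cvec (sqf_poly F) :: nat \<Rightarrow> 'k polynomial) Fs"
  have "linear_quotients n q us"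
    unfolding us_def by (rule linear_quotients_sqf[OF Fs(2)]) (use assms(2) Fs(1) in simp)
  moreover have "\<forall>u\<in>set us. \<forall>c>0. u c = 0" by (auto simp: us_def cvec_def)
  moreover have "(\<lambda>w. w 0) ` pspan n us = mon_ideal n \<F>"
    unfolding us_def using assms(2) Fs(1) by (subst pspan_sqf) (simp_all add: image_image cvec_def)
  ultimately show ?thesis using linear_quotients_imp_linear_resolution by metis
qed

theorem corollary3p4:
  fixes n d :: nat
  shows "(\<forall>C. d_clutter n d C \<and> vertex_decomposable n (complex_of C) \<longrightarrow>
            CF_tree n d C \<and> chordal n d C) \<and>
         (\<forall>\<Delta>. simplicial_complex n \<Delta> \<and> pure_complex \<Delta> \<and> complex_dim \<Delta> = int d \<and>
              vertex_decomposable n \<Delta> \<longrightarrow>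
            has_linear_resolution n
              (stanley_reisner_ideal n (add_small_faces n d \<Delta>) :: 'k::field polynomial set))"
proof (intro conjI allI impI; elim conjE)
  fix C assume C: "d_clutter n d C" "vertex_decomposable n (complex_of C)"
  have unif: "\<forall>F\<in>C. finite F \<and> card F = Suc d"
    using C(1) finite_subset[of _ "{1..n}"] by (auto simp: d_clutter_def)
  have elim: "free_elim d C" using vertex_decomposable_elim_lq[OF C(2) refl unif] by blast
  have "C \<noteq> {}"
    using vertex_decomposable_vertices[OF C(2)] by (auto simp: vertices_def complex_of_def)
  then show "CF_tree n d C" using free_elim_CF_tree C(1) elim by blast
  show "chordal n d C" using free_elim_chordal elim C(1) by blast
next
  fix \<Delta> assume \<Delta>: "simplicial_complex n \<Delta>" "pure_complex \<Delta>" "complex_dim \<Delta> = int d"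
    and vd: "vertex_decomposable n \<Delta>"
  define C where "C = facets \<Delta>"
  have gen: "\<Delta> = complex_of C" and unif: "\<forall>F\<in>C. finite F \<and> card F = Suc d"
    using pure_complex_eq_complex_of[OF \<Delta>] by (simp_all add: C_def)
  \<comment> \<open>The ground set is all of [n], since points that are not vertices of \<Delta>
    still contribute variables and non-faces.\<close>
  have "\<Union>C \<subseteq> {1..n}" using \<Delta>(1) by (auto simp: C_def facets_def simplicial_complex_def)
  then have elim: "free_elim d C" and lq: "has_lq (non_circuits {1..n} (Suc d) C)"
    using vertex_decomposable_elim_lq[OF vd gen unif] by auto
  have sub: "\<forall>F\<in>non_circuits {1..n} (Suc d) C. F \<subseteq> {1..n} \<and> card F = Suc d"
    by (simp add: non_circuits_def)
  have "(\<Prod>i\<in>F. indet i) = (sqf_poly F :: 'k polynomial)"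
    if "F \<in> non_circuits {1..n} (Suc d) C" for F
    using that finite_subset[of F "{1..n}"] by (intro prod_indet) (simp add: non_circuits_def)
  then have "(\<lambda>F. \<Prod>i\<in>F. indet i) ` non_circuits {1..n} (Suc d) C =
      (sqf_poly ` non_circuits {1..n} (Suc d) C :: 'k polynomial set)"
    by (intro image_cong refl)
  then have "(stanley_reisner_ideal n (add_small_faces n d \<Delta>) :: 'k polynomial set) =
      mon_ideal n (non_circuits {1..n} (Suc d) C)"
    unfolding stanley_reisner_ideal_def gen min_nonfaces_add_small_faces[OF unif elim]
    using genideal_mon_ideal[where n = n] sub by metis
  then show "has_linear_resolution n
      (stanley_reisner_ideal n (add_small_faces n d \<Delta>) :: 'k polynomial set)"
    using has_lq_imp_linear_resolution[OF lq sub] by simp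
qed

end
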